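(* Let $\mathfrak{X}$ be a complete class of finite groups, let $G$ be a finite group and let $G^*$ be an epimorphic image of $G$. The following statements are equivalent: (i) there exists an $\mathfrak{X}$-isoschematism $\phi:G\to G^*$; (ii) every epimorphism $\phi:G\to G^*$ is an $\mathfrak{X}$-isoschematism; (iii) $\mathrm{k}_{\mathfrak{X}}(G)=\mathrm{k}_{\mathfrak{X}}(G^* )$.
   Context: All groups are finite. A class of groups is closed under isomorphism. A nonempty class $\mathfrak{X}$ of finite groups is called complete if it is closed under taking subgroups, homomorphic images and extensions; the last means that $G\in\mathfrak{X}$ whenever $G$ has a normal subgroup $N$ with $N\in\mathfrak{X}$ and $G/N\in\mathfrak{X}$. An $\mathfrak{X}$-maximal subgroup of $G$ is a subgroup of $G$ that is maximal by inclusion among the subgroups of $G$ belonging to $\mathfrak{X}$. $\mathrm{k}_{\mathfrak{X}}(G)$ denotes the number of $G$-conjugacy classes of $\mathfrak{X}$-maximal subgroups of $G$. An $\mathfrak{X}$-scheme of $G$ is a complete system of representatives of the conjugacy classes of $\mathfrak{X}$-maximal subgroups of $G$ (one subgroup from each class). An epimorphism $\phi:G\to G^*$ is called an $\mathfrak{X}$-isoschematism if it carries an $\mathfrak{X}$-scheme of $G$ (any one or, equivalently, some one) to an $\mathfrak{X}$-scheme of $G^*$, as systems of representatives: if $H_1,\dots,H_k$ is an $\mathfrak{X}$-scheme of $G$ listed without repetition, then $\phi(H_1),\dots,\phi(H_k)$ is an $\mathfrak{X}$-scheme of $G^*$ listed without repetition. *)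

theory Defs
  imports "HOL-Algebra.Group_Action"
begin

text \<open>
  An isomorphism-closed class of finite groups is represented by its members whose carrier
  consists of natural numbers. Every finite group has an isomorphic copy of this kind, so such
  a set determines the class, and membership of a group over any type is membership of a copy.
\<close>

definition in_class :: "nat monoid set \<Rightarrow> ('a, 'm) monoid_scheme \<Rightarrow> bool"
  where "in_class \<XX> G \<longleftrightarrow> (\<exists>H\<in>\<XX>. G \<cong> H)"

definition group_class :: "nat monoid set \<Rightarrow> bool"
  where "group_class \<XX> \<longleftrightarrow>
    (\<forall>G\<in>\<XX>. group G \<and> finite (carrier G)) \<and>
    (\<forall>G\<in>\<XX>. \<forall>H :: nat monoid. group H \<and> G \<cong> H \<longrightarrow> H \<in> \<XX>)"

definition complete_class :: "nat monoid set \<Rightarrow> bool"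
  where "complete_class \<XX> \<longleftrightarrow>
    group_class \<XX> \<and> \<XX> \<noteq> {} \<and>
    (\<forall>G\<in>\<XX>. \<forall>H. subgroup H G \<longrightarrow> G\<lparr>carrier := H\<rparr> \<in> \<XX>) \<and>
    (\<forall>G\<in>\<XX>. \<forall>(H :: nat monoid) \<phi>. group H \<and> \<phi> \<in> epi G H \<longrightarrow> H \<in> \<XX>) \<and>
    (\<forall>(G :: nat monoid) N. group G \<and> finite (carrier G) \<and> N \<lhd> G \<and>
       G\<lparr>carrier := N\<rparr> \<in> \<XX> \<and> in_class \<XX> (G Mod N) \<longrightarrow> G \<in> \<XX>)"

definition x_subgroup :: "nat monoid set \<Rightarrow> ('a, 'm) monoid_scheme \<Rightarrow> 'a set \<Rightarrow> bool"
  where "x_subgroup \<XX> G H \<longleftrightarrow> subgroup H G \<and> in_class \<XX> (G\<lparr>carrier := H\<rparr>)"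

definition x_maximal :: "nat monoid set \<Rightarrow> ('a, 'm) monoid_scheme \<Rightarrow> 'a set \<Rightarrow> bool"
  where "x_maximal \<XX> G H \<longleftrightarrow>
    x_subgroup \<XX> G H \<and> (\<forall>K. x_subgroup \<XX> G K \<and> H \<subseteq> K \<longrightarrow> K = H)"

definition subgroup_conj :: "('a, 'm) monoid_scheme \<Rightarrow> 'a \<Rightarrow> 'a set \<Rightarrow> 'a set"
  where "subgroup_conj G g H = g <#\<^bsub>G\<^esub> H #>\<^bsub>G\<^esub> inv\<^bsub>G\<^esub> g"

definition k_class :: "nat monoid set \<Rightarrow> ('a, 'm) monoid_scheme \<Rightarrow> nat"
  where "k_class \<XX> G = card (orbits G {H. x_maximal \<XX> G H} (subgroup_conj G))"

definition x_scheme :: "nat monoid set \<Rightarrow> ('a, 'm) monoid_scheme \<Rightarrow> 'a set set \<Rightarrow> bool"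
  where "x_scheme \<XX> G S \<longleftrightarrow>
    (\<forall>H\<in>S. x_maximal \<XX> G H) \<and>
    (\<forall>M. x_maximal \<XX> G M \<longrightarrow> (\<exists>!H. H \<in> S \<and> H \<in> orbit G (subgroup_conj G) M))"

definition carries_scheme ::
    "nat monoid set \<Rightarrow> ('a, 'm) monoid_scheme \<Rightarrow> ('b, 'n) monoid_scheme \<Rightarrow> ('a \<Rightarrow> 'b) \<Rightarrow> 'a set set \<Rightarrow> bool"
  where "carries_scheme \<XX> G G' \<phi> S \<longleftrightarrow>
    inj_on ((`) \<phi>) S \<and> x_scheme \<XX> G' ((`) \<phi> ` S)"

definition isoschematism ::
    "nat monoid set \<Rightarrow> ('a, 'm) monoid_scheme \<Rightarrow> ('b, 'n) monoid_scheme \<Rightarrow> ('a \<Rightarrow> 'b) \<Rightarrow> bool"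
  where "isoschematism \<XX> G G' \<phi> \<longleftrightarrow>
    \<phi> \<in> epi G G' \<and> (\<exists>S. x_scheme \<XX> G S \<and> carries_scheme \<XX> G G' \<phi> S)"

text \<open>
  Whether an epimorphism is an isoschematism does not depend on the choice of the scheme.
\<close>

context group
begin

lemma subgroup_conj_image: "subgroup_conj G g H = (\<lambda>h. g \<otimes> h \<otimes> inv g) ` H"
  unfolding subgroup_conj_def l_coset_def r_coset_def by auto

lemma subgroup_conj_mult:
  assumes "g \<in> carrier G" "k \<in> carrier G" "H \<subseteq> carrier G"
  shows "subgroup_conj G g (subgroup_conj G k H) = subgroup_conj G (g \<otimes> k) H"
  unfolding subgroup_conj_image image_image
  by (rule image_cong) (use assms in \<open>auto simp: m_assoc inv_mult_group subset_iff\<close>)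

lemma subgroup_conj_one:
  assumes "H \<subseteq> carrier G"
  shows "subgroup_conj G \<one> H = H"
  unfolding subgroup_conj_image using assms by (force simp: subset_iff image_iff)

lemma subgroup_conj_subset:
  assumes "g \<in> carrier G" "H \<subseteq> carrier G"
  shows "subgroup_conj G g H \<subseteq> carrier G"
  unfolding subgroup_conj_image using assms by auto

lemma orbit_conj_refl:
  assumes "H \<subseteq> carrier G"
  shows "H \<in> orbit G (subgroup_conj G) H"
  unfolding orbit_def using subgroup_conj_one[OF assms] by force

lemma orbit_conj_sym:
  assumes "H \<subseteq> carrier G" "K \<in> orbit G (subgroup_conj G) H"
  shows "H \<in> orbit G (subgroup_conj G) K"
proof -
  obtain g where g: "g \<in> carrier G" "K = subgroup_conj G g H"
    using assms(2) unfolding orbit_def by auto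
  then have "subgroup_conj G (inv g) K = H"
    using assms(1) by (simp add: subgroup_conj_mult subgroup_conj_one)
  then show ?thesis unfolding orbit_def using g(1) by force
qed

lemma orbit_conj_trans:
  assumes "H \<subseteq> carrier G" "K \<in> orbit G (subgroup_conj G) H" "L \<in> orbit G (subgroup_conj G) K"
  shows "L \<in> orbit G (subgroup_conj G) H"
  using assms(2,3) unfolding orbit_def
  by (auto simp: subgroup_conj_mult[OF _ _ assms(1)])

lemma x_subgroup_conj:
  assumes "x_subgroup \<XX> G H" "g \<in> carrier G"
  shows "x_subgroup \<XX> G (subgroup_conj G g H)"
proof -
  let ?K = "subgroup_conj G g H"
  have H: "subgroup H G" using assms unfolding x_subgroup_def by auto
  then have HG: "H \<subseteq> carrier G" by (rule subgroup.subset)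
  have K: "subgroup ?K G"
    using subgroup_conjugation_is_surj2[OF assms(2) H] unfolding subgroup_conj_def .
  have "(\<lambda>h. g \<otimes> h \<otimes> inv g) \<in> iso (G\<lparr>carrier := H\<rparr>) (G\<lparr>carrier := ?K\<rparr>)"
  proof (rule isoI)
    have "g \<otimes> (x \<otimes> y) \<otimes> inv g = g \<otimes> x \<otimes> inv g \<otimes> (g \<otimes> y \<otimes> inv g)"
      if "x \<in> H" "y \<in> H" for x y
    proof -
      have c: "x \<in> carrier G" "y \<in> carrier G" using that HG by auto
      then have "inv g \<otimes> (g \<otimes> (y \<otimes> inv g)) = y \<otimes> inv g"
        using assms(2) by (metis inv_closed l_inv l_one m_assoc m_closed)
      then show ?thesis using c assms(2) by (simp add: m_assoc)
    qed
    then show "(\<lambda>h. g \<otimes> h \<otimes> inv g) \<in> hom (G\<lparr>carrier := H\<rparr>) (G\<lparr>carrier := ?K\<rparr>)"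
      by (auto simp: hom_def subgroup_conj_image)
    have "inj_on (\<lambda>h. g \<otimes> h \<otimes> inv g) H"
      by (rule inj_onI) (use assms(2) HG in \<open>simp add: subset_iff\<close>)
    then show "bij_betw (\<lambda>h. g \<otimes> h \<otimes> inv g) (carrier (G\<lparr>carrier := H\<rparr>)) (carrier (G\<lparr>carrier := ?K\<rparr>))"
      by (simp add: bij_betw_def subgroup_conj_image)
  qed
  then have "G\<lparr>carrier := H\<rparr> \<cong> G\<lparr>carrier := ?K\<rparr>" by (rule is_isoI)
  then have "G\<lparr>carrier := ?K\<rparr> \<cong> G\<lparr>carrier := H\<rparr>"
    using group.iso_sym[OF subgroup_imp_group[OF H]] by blast
  then show ?thesis using K assms(1) unfolding x_subgroup_def in_class_def
    using iso_trans by blast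
qed

lemma x_maximal_subset: "x_maximal \<XX> G H \<Longrightarrow> H \<subseteq> carrier G"
  unfolding x_maximal_def x_subgroup_def by (simp add: subgroup.subset)

lemma x_maximal_conj:
  assumes "x_maximal \<XX> G H" "K \<in> orbit G (subgroup_conj G) H"
  shows "x_maximal \<XX> G K"
proof -
  obtain g where g: "g \<in> carrier G" "K = subgroup_conj G g H"
    using assms(2) unfolding orbit_def by auto
  have HG: "H \<subseteq> carrier G" using assms(1) by (rule x_maximal_subset)
  have "L = K" if L: "x_subgroup \<XX> G L" "K \<subseteq> L" for L
  proof -
    have LG: "L \<subseteq> carrier G" using L(1) unfolding x_subgroup_def by (simp add: subgroup.subset)
    have "subgroup_conj G (inv g) K \<subseteq> subgroup_conj G (inv g) L"
      using L(2) unfolding subgroup_conj_image by (rule image_mono)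
    then have "H \<subseteq> subgroup_conj G (inv g) L"
      using g HG by (simp add: subgroup_conj_mult subgroup_conj_one)
    then have "subgroup_conj G (inv g) L = H"
      using assms(1) x_subgroup_conj[OF L(1) inv_closed[OF g(1)]] unfolding x_maximal_def by blast
    then show "L = K"
      using g LG by (metis subgroup_conj_mult subgroup_conj_one inv_closed r_inv)
  qed
  then show ?thesis
    using assms(1) g x_subgroup_conj unfolding x_maximal_def by blast
qed

lemma x_scheme_exists: "\<exists>S. x_scheme \<XX> G S"
proof -
  let ?c = "orbit G (subgroup_conj G)"
  let ?S = "{SOME K. K \<in> ?c M | M. x_maximal \<XX> G M}"
  have some: "(SOME K. K \<in> ?c M) \<in> ?c M" if "x_maximal \<XX> G M" for M
    by (rule someI) (rule orbit_conj_refl[OF x_maximal_subset[OF that]])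
  have eq: "?c M = ?c N" if "x_maximal \<XX> G M" "x_maximal \<XX> G N" "K \<in> ?c M" "K \<in> ?c N" for K M N
  proof -
    have sub: "?c M \<subseteq> ?c N" if "x_maximal \<XX> G M" "x_maximal \<XX> G N" "K \<in> ?c M" "K \<in> ?c N" for M N
    proof
      fix L assume "L \<in> ?c M"
      with orbit_conj_sym[OF x_maximal_subset[OF that(1)] that(3)]
      have "L \<in> ?c K"
        using orbit_conj_trans[OF x_maximal_subset[OF x_maximal_conj[OF that(1,3)]]] by simp
      then show "L \<in> ?c N" by (rule orbit_conj_trans[OF x_maximal_subset[OF that(2)] that(4)])
    qed
    show ?thesis using sub[of M N] sub[of N M] that by simp
  qed
  have "x_scheme \<XX> G ?S"
    unfolding x_scheme_def
  proof (intro conjI allI impI ballI)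
    fix H assume "H \<in> ?S" then show "x_maximal \<XX> G H" using some x_maximal_conj by blast
  next
    fix M assume M: "x_maximal \<XX> G M"
    show "\<exists>!H. H \<in> ?S \<and> H \<in> ?c M"
    proof (rule ex1I[where a = "SOME K. K \<in> ?c M"])
      show "(SOME K. K \<in> ?c M) \<in> ?S \<and> (SOME K. K \<in> ?c M) \<in> ?c M" using M some by blast
    next
      fix H assume "H \<in> ?S \<and> H \<in> ?c M"
      then obtain N where N: "x_maximal \<XX> G N" "H = (SOME K. K \<in> ?c N)" "H \<in> ?c M" by blast
      then have "?c N = ?c M" using eq[OF N(1) M _ N(3)] some[OF N(1)] by simp
      then show "H = (SOME K. K \<in> ?c M)" using N(2) by simp
    qed
  qed
  then show ?thesis by blast
qed

end

lemma image_orbit_conj: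
  assumes "group G" "group G'" "\<phi> \<in> hom G G'" "H \<subseteq> carrier G"
    and "K \<in> orbit G (subgroup_conj G) H"
  shows "\<phi> ` K \<in> orbit G' (subgroup_conj G') (\<phi> ` H)"
proof -
  interpret group_hom G G' \<phi>
    using assms by (simp add: group_hom_def group_hom_axioms_def)
  obtain g where g: "g \<in> carrier G" "K = subgroup_conj G g H"
    using assms(5) unfolding orbit_def by auto
  have "\<phi> ` K = subgroup_conj G' (\<phi> g) (\<phi> ` H)"
    unfolding g(2) G.subgroup_conj_image H.subgroup_conj_image image_image
    by (rule image_cong) (use g assms(4) in \<open>auto simp: subset_iff\<close>)
  then show ?thesis unfolding orbit_def using g by auto
qed

lemma carries_scheme_any:
  assumes "group G" "group G'" "\<phi> \<in> hom G G'"
    and S: "x_scheme \<XX> G S" "carries_scheme \<XX> G G' \<phi> S" and T: "x_scheme \<XX> G T"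
  shows "carries_scheme \<XX> G G' \<phi> T"
proof -
  interpret G: group G by fact
  interpret G': group G' by fact
  let ?c = "orbit G (subgroup_conj G)"
  let ?d = "orbit G' (subgroup_conj G')"
  have maxS: "x_maximal \<XX> G H" if "H \<in> S" for H using S(1) that unfolding x_scheme_def by blast
  have maxT: "x_maximal \<XX> G H" if "H \<in> T" for H using T that unfolding x_scheme_def by blast
  have maxI: "x_maximal \<XX> G' (\<phi> ` H)" if "H \<in> S" for H
    using S(2) that unfolding carries_scheme_def x_scheme_def by blast
  have "\<exists>K. K \<in> S \<and> K \<in> ?c H" if "H \<in> T" for H
    using S(1) maxT[OF that] unfolding x_scheme_def by blast
  then obtain r where r: "r H \<in> S" "r H \<in> ?c H" if "H \<in> T" for H by metis
  have im: "\<phi> ` r H \<in> ?d (\<phi> ` H)" "\<phi> ` H \<in> ?d (\<phi> ` r H)" if "H \<in> T" for H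
  proof -
    note HT = G.x_maximal_subset[OF maxT[OF that]]
    show "\<phi> ` r H \<in> ?d (\<phi> ` H)"
      by (rule image_orbit_conj[OF assms(1-3) HT r(2)[OF that]])
    show "\<phi> ` H \<in> ?d (\<phi> ` r H)"
      by (rule image_orbit_conj[OF assms(1-3) G.x_maximal_subset[OF maxS[OF r(1)[OF that]]]
            G.orbit_conj_sym[OF HT r(2)[OF that]]])
  qed
  have maxJ: "x_maximal \<XX> G' (\<phi> ` H)" if "H \<in> T" for H
    using G'.x_maximal_conj[OF maxI[OF r(1)[OF that]] im(2)[OF that]] .
  have uniq: "H = K"
    if H: "H \<in> T" and K: "K \<in> T" and M: "x_maximal \<XX> G' M" "\<phi> ` H \<in> ?d M" "\<phi> ` K \<in> ?d M" for H K M
  proof -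
    have "\<phi> ` r H \<in> ?d M" "\<phi> ` r K \<in> ?d M"
      using G'.orbit_conj_trans[OF G'.x_maximal_subset[OF M(1)]] M(2,3) im(1) H K by blast+
    moreover have "\<exists>!L. L \<in> (`) \<phi> ` S \<and> L \<in> ?d M"
      using S(2) M(1) unfolding carries_scheme_def x_scheme_def by simp
    moreover have "\<phi> ` r H \<in> (`) \<phi> ` S" "\<phi> ` r K \<in> (`) \<phi> ` S"
      using r(1) H K by simp_all
    ultimately have "\<phi> ` r H = \<phi> ` r K" by metis
    then have "r H = r K"
      using S(2) r(1)[OF H] r(1)[OF K] unfolding carries_scheme_def by (simp add: inj_on_def)
    then have "K \<in> ?c H"
      using G.orbit_conj_trans[OF G.x_maximal_subset[OF maxT[OF H]] r(2)[OF H]]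
        G.orbit_conj_sym[OF G.x_maximal_subset[OF maxT[OF K]] r(2)[OF K]] by simp
    moreover have "\<exists>!L. L \<in> T \<and> L \<in> ?c H"
      using T maxT[OF H] unfolding x_scheme_def by simp
    moreover have "H \<in> ?c H"
      by (rule G.orbit_conj_refl[OF G.x_maximal_subset[OF maxT[OF H]]])
    ultimately show "H = K" using H K by metis
  qed
  have ex: "\<exists>H\<in>T. \<phi> ` H \<in> ?d M" if M: "x_maximal \<XX> G' M" for M
  proof -
    have "\<exists>!L. L \<in> (`) \<phi> ` S \<and> L \<in> ?d M"
      using S(2) M unfolding carries_scheme_def x_scheme_def by simp
    then obtain K where K: "K \<in> S" "\<phi> ` K \<in> ?d M" by auto
    obtain H where H: "H \<in> T" "H \<in> ?c K"
      using T maxS[OF K(1)] unfolding x_scheme_def by blast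
    have "\<phi> ` H \<in> ?d (\<phi> ` K)"
      using image_orbit_conj[OF assms(1-3) G.x_maximal_subset[OF maxS[OF K(1)]] H(2)] .
    then show ?thesis
      using G'.orbit_conj_trans[OF G'.x_maximal_subset[OF M] K(2)] H(1) by blast
  qed
  show ?thesis
    unfolding carries_scheme_def
  proof
    show "inj_on ((`) \<phi>) T"
    proof (rule inj_onI)
      fix H K assume HK: "H \<in> T" "K \<in> T" "\<phi> ` H = \<phi> ` K"
      then show "H = K"
        using uniq[OF HK(1,2) maxJ[OF HK(1)]] G'.orbit_conj_refl[OF G'.x_maximal_subset[OF maxJ[OF HK(1)]]]
        by simp
    qed
    show "x_scheme \<XX> G' ((`) \<phi> ` T)"
      unfolding x_scheme_def
    proof (intro conjI ballI allI impI)
      fix H' assume "H' \<in> (`) \<phi> ` T"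
      then show "x_maximal \<XX> G' H'" using maxJ by auto
    next
      fix M assume M: "x_maximal \<XX> G' M"
      obtain H where H: "H \<in> T" "\<phi> ` H \<in> ?d M" using ex[OF M] by blast
      show "\<exists>!L. L \<in> (`) \<phi> ` T \<and> L \<in> ?d M"
      proof (rule ex1I[where a = "\<phi> ` H"])
        show "\<phi> ` H \<in> (`) \<phi> ` T \<and> \<phi> ` H \<in> ?d M" using H by simp
      next
        fix L assume "L \<in> (`) \<phi> ` T \<and> L \<in> ?d M"
        then obtain K where "K \<in> T" "L = \<phi> ` K" "\<phi> ` K \<in> ?d M" by blast
        then show "L = \<phi> ` H" using uniq[OF H(1) _ M H(2)] by blast
      qed
    qed
  qed
qed

lemma isoschematism_iff_all:
  assumes "group G" "group G'"
  shows "isoschematism \<XX> G G' \<phi> \<longleftrightarrow>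
    \<phi> \<in> epi G G' \<and> (\<forall>S. x_scheme \<XX> G S \<longrightarrow> carries_scheme \<XX> G G' \<phi> S)"
proof (cases "\<phi> \<in> epi G G'")
  case True
  then have "\<phi> \<in> hom G G'" by (simp add: epi_def)
  then show ?thesis
    using True carries_scheme_any[OF assms] group.x_scheme_exists[OF assms(1)]
    unfolding isoschematism_def by metis
qed (simp add: isoschematism_def)

end

theory Submission
  imports Defs "HOL-Algebra.Weak_Morphisms" "HOL-Algebra.Sylow" "HOL-Algebra.Multiplicative_Group"
begin

text \<open>
  An isoschematism matches the classes of \<open>\<XX>\<close>-maximal subgroups of \<open>G\<close> and \<open>G'\<close> one to one, so it
  preserves their number. Conversely, let \<open>\<phi>\<close> be any epimorphism. Every \<open>\<XX>\<close>-maximal subgroup \<open>K\<close>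
  of \<open>G'\<close> is the image of an \<open>\<XX>\<close>-maximal subgroup of \<open>G\<close> (\<open>x_maximal_is_image\<close>). Choosing
  one for each member of a scheme of \<open>G'\<close> gives pairwise non-conjugate subgroups of \<open>G\<close>; if both
  groups have the same finite number of classes, these subgroups form a scheme of \<open>G\<close>, which \<open>\<phi>\<close>
  carries to the chosen scheme of \<open>G'\<close>. As \<open>\<phi>\<close> was arbitrary, equality of the numbers makes every
  epimorphism an isoschematism.

  The substance is that an \<open>\<XX>\<close>-subgroup \<open>K\<close> of \<open>G'\<close> is the image of some \<open>\<XX>\<close>-subgroup of
  \<open>G\<close> (\<open>lift_x_subgroup\<close>); an \<open>\<XX>\<close>-maximal subgroup above the latter then maps onto \<open>K\<close> when
  \<open>K\<close> is maximal. A minimal subgroup \<open>S\<close> of \<open>G\<close> that \<open>\<phi>\<close> maps onto \<open>K\<close> does it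
  (\<open>minimal_cover_in_class\<close>): the kernel of \<open>\<phi>\<close> on \<open>S\<close> has only normal Sylow subgroups by the
  Frattini argument (\<open>frattini\<close>), and only primes dividing the order of \<open>K\<close> occur in it, since a
  normal Sylow subgroup of \<open>S\<close> has a proper supplement by the averaging argument of Schur and
  Zassenhaus (\<open>normal_sylow_proper_supplement\<close>). For such primes all \<open>p\<close>-groups belong to \<open>\<XX>\<close>
  (\<open>p_group_in_class\<close>), so the kernel belongs to \<open>\<XX>\<close>, and with it the extension \<open>S\<close>.
\<close>

section \<open>Complete classes over arbitrary carrier types\<close>

lemma exists_nat_copy:
  assumes "group G" "finite (carrier G)"
  shows "\<exists>H :: nat monoid. group H \<and> G \<cong> H"
proof -
  obtain f :: "'a \<Rightarrow> nat" where f: "inj_on f (carrier G)"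
    using finite_imp_inj_to_nat_seg[OF assms(2)] by blast
  have "group (image_group f G)"
    using group.inj_imp_image_group_is_group[OF assms(1) f] .
  moreover have "G \<cong> image_group f G"
    using inj_imp_image_group_iso[OF f] by (rule is_isoI)
  ultimately show ?thesis by blast
qed

lemma in_class_nat:
  assumes "complete_class \<XX>" "group G"
  shows "in_class \<XX> G \<longleftrightarrow> G \<in> \<XX>"
proof
  assume "in_class \<XX> G"
  then obtain H where H: "H \<in> \<XX>" "G \<cong> H" unfolding in_class_def by blast
  have "H \<cong> G" using group.iso_sym[OF assms(2) H(2)] .
  then show "G \<in> \<XX>"
    using assms H unfolding complete_class_def group_class_def by blast
next
  assume "G \<in> \<XX>"
  then show "in_class \<XX> G" unfolding in_class_def using iso_refl by blast
qed

lemma in_class_obtain_copy: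
  assumes "complete_class \<XX>" "in_class \<XX> G" "group G"
  obtains G0 h where "G0 \<in> \<XX>" "group G0" "h \<in> iso G0 G"
proof -
  obtain H where H: "H \<in> \<XX>" "G \<cong> H" using assms(2) unfolding in_class_def by blast
  have "group H" using assms(1) H(1) unfolding complete_class_def group_class_def by blast
  moreover have "H \<cong> G" using group.iso_sym[OF assms(3) H(2)] .
  ultimately show ?thesis using that H(1) unfolding is_iso_def by blast
qed

lemma in_class_epi:
  assumes \<XX>: "complete_class \<XX>" and G: "group G" "in_class \<XX> G"
    and H: "group H" and f: "f \<in> epi G H"
  shows "in_class \<XX> H"
proof -
  obtain G0 h where G0: "G0 \<in> \<XX>" "group G0" "h \<in> iso G0 G"
    using in_class_obtain_copy[OF \<XX> G(2,1)] .
  have "finite (carrier G0)"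
    using \<XX> G0(1) unfolding complete_class_def group_class_def by blast
  then have "finite (carrier G)"
    using G0(3) bij_betw_finite unfolding iso_def by blast
  then have fin: "finite (carrier H)" using f unfolding epi_def by (metis (mono_tags, lifting) finite_imageI mem_Collect_eq)
  obtain H0 :: "nat monoid" where H0: "group H0" "H \<cong> H0"
    using exists_nat_copy[OF H fin] by blast
  then obtain k where k: "k \<in> iso H H0" unfolding is_iso_def by blast
  have "k \<circ> (f \<circ> h) \<in> epi G0 H0"
    using G0(3) f k by (meson epi_compose iso_iff_mon_epi)
  then have "H0 \<in> \<XX>"
    using \<XX> G0(1) H0(1) unfolding complete_class_def by blast
  then show ?thesis using H0(2) unfolding in_class_def by blast
qed

lemma (in group) trivial_in_class:
  assumes "complete_class \<XX>" and C: "group C" "in_class \<XX> C"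
  shows "in_class \<XX> (G\<lparr>carrier := {\<one>}\<rparr>)"
proof (rule in_class_epi[OF assms])
  interpret C: group C by fact
  show "group (G\<lparr>carrier := {\<one>}\<rparr>)" by (rule subgroup_imp_group[OF triv_subgroup])
  show "(\<lambda>_. \<one>) \<in> epi C (G\<lparr>carrier := {\<one>}\<rparr>)"
    using C.one_closed by (auto simp: epi_def hom_def)
qed

lemma in_class_subgroup:
  assumes \<XX>: "complete_class \<XX>" and G: "group G" "in_class \<XX> G" and S: "subgroup S G"
  shows "in_class \<XX> (G\<lparr>carrier := S\<rparr>)"
proof -
  obtain G0 h where G0: "G0 \<in> \<XX>" "group G0" "h \<in> iso G0 G"
    using in_class_obtain_copy[OF \<XX> G(2,1)] .
  define k where "k = inv_into (carrier G0) h"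
  have k: "k \<in> iso G G0" unfolding k_def
    using group.iso_set_sym[OF G0(2,3)] .
  interpret k: group_hom G G0 k
    using k G(1) G0(2) by (simp add: group_hom_def group_hom_axioms_def iso_def)
  have sub: "subgroup (k ` S) G0" using k.subgroup_img_is_subgroup[OF S] .
  have "restrict k S \<in> iso (G\<lparr>carrier := S\<rparr>) (G0\<lparr>carrier := k ` S\<rparr>)"
    by (rule iso_restrict[OF k G(1) G0(2) S])
  then have "G\<lparr>carrier := S\<rparr> \<cong> G0\<lparr>carrier := k ` S\<rparr>" by (rule is_isoI)
  moreover have "G0\<lparr>carrier := k ` S\<rparr> \<in> \<XX>"
    using \<XX> G0(1) sub unfolding complete_class_def by blast
  ultimately show ?thesis unfolding in_class_def by blast
qed

text \<open>
  The closure under extensions speaks of a normal subgroup and its quotient. Replacing these by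
  the kernel and the image of a homomorphism makes the rule applicable to subgroups of quotient
  groups without naming the quotient itself.
\<close>

lemma in_class_extension:
  assumes \<XX>: "complete_class \<XX>" and G: "group G" "finite (carrier G)"
    and K: "group K" and f: "f \<in> hom G K"
    and ker: "in_class \<XX> (G\<lparr>carrier := kernel G K f\<rparr>)"
    and img: "in_class \<XX> (K\<lparr>carrier := f ` carrier G\<rparr>)"
  shows "in_class \<XX> G"
proof -
  obtain G0 :: "nat monoid" where G0: "group G0" "G \<cong> G0"
    using exists_nat_copy[OF G] by blast
  obtain h where h: "h \<in> iso G0 G"
    using group.iso_sym[OF G(1) G0(2)] unfolding is_iso_def by blast
  have hh: "h \<in> hom G0 G" "h ` carrier G0 = carrier G" "inj_on h (carrier G0)"
    using h unfolding iso_def bij_betw_def by auto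
  let ?K = "K\<lparr>carrier := f ` carrier G\<rparr>"
  interpret f: group_hom G K f
    using f G K by (simp add: group_hom_def group_hom_axioms_def)
  have grK: "group ?K"
    using f.img_is_subgroup group.subgroup_imp_group[OF K] by blast
  have fh: "f \<circ> h \<in> hom G0 ?K"
    using hh(1,2) f by (auto simp: hom_def Pi_def)
  interpret fh: group_hom G0 ?K "f \<circ> h"
    using fh G0(1) grK by (simp add: group_hom_def group_hom_axioms_def)
  let ?N = "kernel G0 ?K (f \<circ> h)"
  have surj: "(f \<circ> h) ` carrier G0 = carrier ?K"
    using hh(2) by (simp only: image_comp[symmetric]) simp
  have Nim: "h ` ?N = kernel G K f"
    unfolding kernel_def using hh(2) by auto
  have fin0: "finite (carrier G0)" using G(2) hh finite_image_iff by metis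
  have N: "?N \<lhd> G0" by (rule fh.normal_kernel)
  have grN: "group (G0\<lparr>carrier := ?N\<rparr>)"
    using G0(1) N by (simp add: group.subgroup_imp_group normal_imp_subgroup)
  have "h \<in> iso (G0\<lparr>carrier := ?N\<rparr>) (G\<lparr>carrier := kernel G K f\<rparr>)"
  proof (rule isoI)
    show "h \<in> hom (G0\<lparr>carrier := ?N\<rparr>) (G\<lparr>carrier := kernel G K f\<rparr>)"
      using hh(1) Nim by (auto simp: hom_def kernel_def Pi_def)
    show "bij_betw h (carrier (G0\<lparr>carrier := ?N\<rparr>)) (carrier (G\<lparr>carrier := kernel G K f\<rparr>))"
      using Nim hh(3) by (auto simp: bij_betw_def kernel_def inj_on_def)
  qed
  then have "in_class \<XX> (G0\<lparr>carrier := ?N\<rparr>)"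
    using ker iso_trans is_isoI unfolding in_class_def by blast
  then have "G0\<lparr>carrier := ?N\<rparr> \<in> \<XX>" using in_class_nat[OF \<XX> grN] by blast
  moreover have "in_class \<XX> (G0 Mod ?N)"
    using fh.FactGroup_iso[OF surj] img iso_trans unfolding in_class_def by blast
  ultimately have "G0 \<in> \<XX>"
    using \<XX> G0(1) fin0 N unfolding complete_class_def by blast
  then show ?thesis using G0(2) unfolding in_class_def by blast
qed

lemma in_class_image:
  assumes \<XX>: "complete_class \<XX>" and GK: "group G" "group K" and f: "f \<in> hom G K"
    and A: "subgroup A G" "in_class \<XX> (G\<lparr>carrier := A\<rparr>)"
  shows "in_class \<XX> (K\<lparr>carrier := f ` A\<rparr>)"
proof (rule in_class_epi[OF \<XX> _ A(2)])
  interpret f: group_hom G K f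
    using f GK by (simp add: group_hom_def group_hom_axioms_def)
  show "group (G\<lparr>carrier := A\<rparr>)" using A(1) by (rule group.subgroup_imp_group[OF GK(1)])
  show "group (K\<lparr>carrier := f ` A\<rparr>)"
    using f.subgroup_img_is_subgroup[OF A(1)] by (rule group.subgroup_imp_group[OF GK(2)])
  show "f \<in> epi (G\<lparr>carrier := A\<rparr>) (K\<lparr>carrier := f ` A\<rparr>)"
    using f subgroup.subset[OF A(1)] by (auto simp: epi_def hom_def Pi_def subset_iff)
qed

section \<open>Finite \<open>p\<close>-groups\<close>

text \<open>
  Orbits of a \<open>p\<close>-group have \<open>p\<close>-power length, so without a fixed point every orbit length,
  and with them the size of the whole set, would be divisible by \<open>p\<close>. The action is given by a
  plain function rather than by a homomorphism into the symmetric group: the conjugations and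
  translations below then need no restriction to the set acted upon.
\<close>

lemma p_group_fixed_point:
  assumes G: "group G" and p: "prime p" "order G = p ^ n"
    and E: "finite E" "\<not> p dvd card E"
    and act: "\<And>g x. g \<in> carrier G \<Longrightarrow> x \<in> E \<Longrightarrow> a g x \<in> E"
      "\<And>x. x \<in> E \<Longrightarrow> a \<one>\<^bsub>G\<^esub> x = x"
      "\<And>g h x. g \<in> carrier G \<Longrightarrow> h \<in> carrier G \<Longrightarrow> x \<in> E \<Longrightarrow> a g (a h x) = a (g \<otimes>\<^bsub>G\<^esub> h) x"
  shows "\<exists>x\<in>E. \<forall>g\<in>carrier G. a g x = x"
proof (rule ccontr)
  assume no_fix: "\<not> ?thesis"
  interpret group G by fact
  let ?a = "\<lambda>g. restrict (a g) E"
  have inverse: "a (inv\<^bsub>G\<^esub> g) (a g x) = x" "a g (a (inv\<^bsub>G\<^esub> g) x) = x" if "g \<in> carrier G" "x \<in> E" for g x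
    using that act by auto
  have bij: "?a g \<in> Bij E" if "g \<in> carrier G" for g
  proof -
    have "bij_betw (a g) E E"
      by (rule bij_betw_byWitness[where f' = "a (inv\<^bsub>G\<^esub> g)"]) (use that act(1) inverse in auto)
    then show ?thesis by (auto simp: Bij_def bij_betw_def inj_on_def)
  qed
  have "?a \<in> hom G (BijGroup E)"
    by (rule homI)
      (use bij act in \<open>auto simp: BijGroup_def compose_def fun_eq_iff restrict_def\<close>)
  then interpret group_action G E ?a
    using group_BijGroup by (simp add: group_action_def group_hom_def group_hom_axioms_def)
  have div: "p dvd card C" if C: "C \<in> orbits G E ?a" for C
  proof -
    obtain x where x: "x \<in> E" "C = orbit G ?a x" using C unfolding orbits_def by blast
    have "card C dvd p ^ n"
      using orbit_stabilizer_theorem[OF x(1)] x(2) p(2) by (metis dvd_triv_left)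
    then obtain i where i: "card C = p ^ i" using p(1) divides_primepow_nat by blast
    have "i \<noteq> 0"
    proof
      assume "i = 0"
      then have "card C = 1" using i by simp
      then obtain y where y: "C = {y}" using card_1_singletonE by blast
      have xC: "a g x \<in> C" if "g \<in> carrier G" for g
        using that x unfolding orbit_def by force
      have "a \<one>\<^bsub>G\<^esub> x \<in> C" by (rule xC) simp
      then have "\<forall>g\<in>carrier G. a g x = x" using xC y act(2)[OF x(1)] by auto
      then show False using no_fix x(1) by blast
    qed
    then show ?thesis using i by simp
  qed
  have "card E = (\<Sum>C\<in>orbits G E ?a. card C)"
    using disjoint_sum[OF E(1), of "\<lambda>_. 1::nat"] by simp
  then have "p dvd card E" using div by (simp add: dvd_sum)
  then show False using E(2) by blast
qed

lemma (in group) subgroup_of_prime_order: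
  assumes "prime p" "p dvd order G" "finite (carrier G)"
  obtains H where "subgroup H G" "card H = p"
proof -
  obtain m where "order G = p ^ 1 * m" using assms(2) by (auto elim: dvdE)
  then show ?thesis using sylow_thm[OF assms(1) is_group _ assms(3)] that by (metis power_one_right)
qed

lemma (in group) exists_sylow_subgroup:
  assumes "prime p" "finite (carrier G)"
  obtains P n where "subgroup P G" "card P = p ^ n" "\<not> p dvd order G div p ^ n" "n = multiplicity p (order G)"
proof -
  have pos: "order G > 0" using assms(2) by (simp add: order_gt_0_iff_finite)
  define n where "n = multiplicity p (order G)"
  have eq: "order G = p ^ n * (order G div p ^ n)"
    unfolding n_def using multiplicity_dvd by (metis dvd_mult_div_cancel)
  obtain P where P: "subgroup P G" "card P = p ^ n"
    using sylow_thm[OF assms(1) is_group eq assms(2)] by blast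
  have "\<not> p dvd order G div p ^ n"
  proof -
    have "\<not> is_unit p" using assms(1) by (simp add: prime_nat_iff)
    then show ?thesis unfolding n_def
      using multiplicity_decompose[of "order G" p] pos by (simp)
  qed
  then show ?thesis using that P n_def by blast
qed

text \<open>
  Conjugation acts on the nontrivial elements, whose number \<open>p ^ n - 1\<close> is prime to \<open>p\<close>; a fixed
  point is a central element.
\<close>

lemma (in group) p_group_center_nontrivial:
  assumes "prime p" "order G = p ^ n" "n > 0"
  obtains z where "z \<in> carrier G" "z \<noteq> \<one>" "\<And>g. g \<in> carrier G \<Longrightarrow> g \<otimes> z = z \<otimes> g"
proof -
  have fin: "finite (carrier G)"
    using assms by (simp add: prime_gt_0_nat flip: order_gt_0_iff_finite)
  let ?E = "carrier G - {\<one>}"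
  let ?a = "\<lambda>g x. g \<otimes> x \<otimes> inv g"
  have "card ?E = p ^ n - 1" using fin assms(2) by (simp add: order_def)
  moreover have "\<not> p dvd p ^ n - 1"
  proof
    assume "p dvd p ^ n - 1"
    moreover have "p dvd p ^ n" using assms(3) by simp
    moreover have "p ^ n \<ge> 1" using prime_gt_0_nat[OF assms(1)] by (simp add: Suc_leI)
    ultimately have "p dvd 1" by (metis diff_diff_cancel dvd_diff_nat)
    then show False using assms(1) by (simp add: prime_nat_iff)
  qed
  ultimately have ndvd: "\<not> p dvd card ?E" by simp
  have "\<exists>z\<in>?E. \<forall>g\<in>carrier G. ?a g z = z"
  proof (rule p_group_fixed_point[OF is_group assms(1,2) _ ndvd])
    show "finite ?E" using fin by simp
  next
    fix g x assume gx: "g \<in> carrier G" "x \<in> ?E"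
    have "g \<otimes> x \<otimes> inv g \<noteq> \<one>"
    proof
      assume "g \<otimes> x \<otimes> inv g = \<one>"
      then have "g \<otimes> x = g" using gx inv_equality[of "g \<otimes> x" "inv g"] by auto
      then show False using gx by simp
    qed
    then show "?a g x \<in> ?E" using gx by simp
  next
    fix g h x assume "g \<in> carrier G" "h \<in> carrier G" "x \<in> ?E"
    then show "?a g (?a h x) = ?a (g \<otimes> h) x" by (simp add: m_assoc inv_mult_group)
  qed simp
  then obtain z where z: "z \<in> ?E" "\<And>g. g \<in> carrier G \<Longrightarrow> g \<otimes> z \<otimes> inv g = z" by blast
  have "g \<otimes> z = z \<otimes> g" if "g \<in> carrier G" for g
    using z(1) z(2)[OF that] that by (metis DiffD1 inv_solve_right' m_closed)
  then show ?thesis using that z(1) by blast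
qed

definition center :: "('a, 'm) monoid_scheme \<Rightarrow> 'a set"
  where "center G = {z \<in> carrier G. \<forall>g\<in>carrier G. g \<otimes>\<^bsub>G\<^esub> z = z \<otimes>\<^bsub>G\<^esub> g}"

lemma (in group) center_subgroup: "subgroup (center G) G"
proof (rule subgroupI)
  show "center G \<noteq> {}" unfolding center_def by (auto intro!: exI[of _ \<one>])
next
  fix a assume a: "a \<in> center G"
  have "g \<otimes> inv a = inv a \<otimes> g" if "g \<in> carrier G" for g
  proof -
    have aG: "a \<in> carrier G" and "g \<otimes> a = a \<otimes> g" using a that unfolding center_def by auto
    then have "inv a \<otimes> (g \<otimes> a) \<otimes> inv a = inv a \<otimes> (a \<otimes> g) \<otimes> inv a" by simp
    moreover have "inv a \<otimes> (g \<otimes> a) \<otimes> inv a = inv a \<otimes> g" using aG that by (simp add: m_assoc)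
    moreover have "inv a \<otimes> (a \<otimes> g) \<otimes> inv a = g \<otimes> inv a" using aG that by (simp flip: m_assoc)
    ultimately show ?thesis by simp
  qed
  moreover have "inv a \<in> carrier G" using a unfolding center_def by blast
  ultimately show "inv a \<in> center G" unfolding center_def by blast
next
  fix a b assume ab: "a \<in> center G" "b \<in> center G"
  have "g \<otimes> (a \<otimes> b) = a \<otimes> b \<otimes> g" if "g \<in> carrier G" for g
  proof -
    have c: "a \<in> carrier G" "b \<in> carrier G" "g \<otimes> a = a \<otimes> g" "g \<otimes> b = b \<otimes> g"
      using ab that unfolding center_def by auto
    have "g \<otimes> (a \<otimes> b) = a \<otimes> (g \<otimes> b)" using c that by (metis m_assoc)
    then show ?thesis using c that by (simp add: m_assoc)
  qed
  moreover have "a \<otimes> b \<in> carrier G" using ab unfolding center_def by blast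
  ultimately show "a \<otimes> b \<in> center G" unfolding center_def by blast
qed (auto simp: center_def)

lemma (in group) normal_subgroupI:
  assumes "subgroup N G" "\<And>g x. g \<in> carrier G \<Longrightarrow> x \<in> N \<Longrightarrow> g \<otimes> x \<otimes> inv g \<in> N"
  shows "N \<lhd> G"
  using assms normal_inv_iff by blast

lemma (in group) normal_conj:
  assumes "N \<lhd> G" "g \<in> carrier G" "x \<in> N"
  shows "g \<otimes> x \<otimes> inv g \<in> N"
  using assms normal_inv_iff by blast

lemma (in group) central_subgroup_normal:
  assumes "subgroup M G" "M \<subseteq> center G"
  shows "M \<lhd> G"
proof (rule normal_subgroupI[OF assms(1)])
  fix g x assume gx: "g \<in> carrier G" "x \<in> M"
  then have x: "x \<in> carrier G" "g \<otimes> x = x \<otimes> g" using assms(2) unfolding center_def by auto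
  have "g \<otimes> x \<otimes> inv g = x"
    using gx(1) x by (simp add: m_assoc)
  then show "g \<otimes> x \<otimes> inv g \<in> M" using gx by simp
qed

lemma (in group) p_group_normal_prime_order:
  assumes "prime p" "order G = p ^ n" "n > 0"
  obtains M where "M \<lhd> G" "card M = p"
proof -
  let ?Z = "G\<lparr>carrier := center G\<rparr>"
  have fin: "finite (carrier G)"
    using assms by (simp add: prime_gt_0_nat flip: order_gt_0_iff_finite)
  have grZ: "group ?Z" using subgroup_imp_group[OF center_subgroup] .
  have finZ: "finite (center G)" using fin unfolding center_def by simp
  have "card (center G) dvd p ^ n"
    using lagrange[OF center_subgroup] assms(2) by (metis dvd_triv_right)
  then obtain k where k: "card (center G) = p ^ k"
    using assms(1) divides_primepow_nat by blast
  obtain z where "z \<in> carrier G" "z \<noteq> \<one>" "\<And>g. g \<in> carrier G \<Longrightarrow> g \<otimes> z = z \<otimes> g"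
    using p_group_center_nontrivial[OF assms] by blast
  then have "{\<one>, z} \<subseteq> center G" "card {\<one>, z} = 2" unfolding center_def by auto
  then have "card (center G) \<ge> 2" using card_mono[OF finZ] by metis
  then have "k \<noteq> 0" using k by (cases k) auto
  then have "p dvd order ?Z" using k by (simp add: order_def)
  then obtain M where M: "subgroup M ?Z" "card M = p"
    using group.subgroup_of_prime_order[OF grZ assms(1)] finZ by auto
  have "subgroup M G" using incl_subgroup[OF center_subgroup M(1)] .
  moreover have "M \<subseteq> center G" using subgroup.subset[OF M(1)] by simp
  ultimately show ?thesis using that M(2) central_subgroup_normal by blast
qed

context group_hom
begin

lemma card_image_kernel:
  "card (h ` carrier G) * card (kernel G H h) = order G"
proof -
  let ?K = "H\<lparr>carrier := h ` carrier G\<rparr>"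
  have "group ?K" by (rule H.subgroup_imp_group[OF img_is_subgroup])
  moreover have "h \<in> hom G ?K" using homh by (simp add: hom_def Pi_def)
  ultimately have hom: "group_hom G ?K h"
    by (simp add: group_hom_def group_hom_axioms_def)
  have ker: "kernel G ?K h = kernel G H h" by (simp add: kernel_def)
  have "card (carrier (G Mod kernel G H h)) = card (h ` carrier G)"
    using iso_same_card[OF group_hom.FactGroup_iso[OF hom]] by (simp add: ker)
  then show ?thesis
    using G.lagrange[OF subgroup_kernel] by (simp add: FactGroup_def)
qed

lemma preimage_subgroup:
  assumes "subgroup M H"
  shows "subgroup {x \<in> carrier G. h x \<in> M} G"
proof (rule G.subgroupI)
  have "\<one> \<in> {x \<in> carrier G. h x \<in> M}" using subgroup.one_closed[OF assms] by simp
  then show "{x \<in> carrier G. h x \<in> M} \<noteq> {}" by blast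
next
  fix x assume "x \<in> {x \<in> carrier G. h x \<in> M}"
  then show "inv x \<in> {x \<in> carrier G. h x \<in> M}"
    using subgroup.m_inv_closed[OF assms, of "h x"] by simp
next
  fix x y assume "x \<in> {x \<in> carrier G. h x \<in> M}" "y \<in> {x \<in> carrier G. h x \<in> M}"
  then show "x \<otimes> y \<in> {x \<in> carrier G. h x \<in> M}"
    using subgroup.m_closed[OF assms, of "h x" "h y"] by simp
qed blast

lemma preimage_normal:
  assumes "M \<lhd> H"
  shows "{x \<in> carrier G. h x \<in> M} \<lhd> G"
proof (rule G.normal_subgroupI[OF preimage_subgroup[OF normal_imp_subgroup[OF assms]]])
  fix g x assume "g \<in> carrier G" "x \<in> {x \<in> carrier G. h x \<in> M}"
  then show "g \<otimes> x \<otimes> inv g \<in> {x \<in> carrier G. h x \<in> M}"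
    using H.normal_conj[OF assms, of "h g" "h x"] by simp
qed

end

lemma (in normal) quotient_hom: "group_hom G (G Mod H) (\<lambda>x. H #> x)"
  unfolding group_hom_def group_hom_axioms_def
  using factorgroup_is_group r_coset_hom_Mod is_group by blast

lemma (in normal) quotient_surj: "(\<lambda>x. H #> x) ` carrier G = carrier (G Mod H)"
  by (simp add: carrier_FactGroup)

lemma (in normal) quotient_eq_one_iff:
  assumes "x \<in> carrier G"
  shows "H #> x = H \<longleftrightarrow> x \<in> H"
  using coset_join1[OF _ assms subgroup_axioms] coset_join2[OF assms subgroup_axioms] by blast

lemma (in normal) quotient_kernel: "kernel G (G Mod H) (\<lambda>x. H #> x) = H"
proof -
  have "kernel G (G Mod H) (\<lambda>x. H #> x) = {x \<in> carrier G. x \<in> H}"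
    unfolding kernel_def one_FactGroup using quotient_eq_one_iff by blast
  then show ?thesis using subset by blast
qed

lemma (in group) prime_order_generator:
  assumes "prime p" "order G = p"
  obtains x where "x \<in> carrier G" "\<And>i j::int. x [^] i = x [^] j \<longleftrightarrow> int p dvd j - i"
    "carrier G = range (\<lambda>i::int. x [^] i)"
proof -
  have fin: "finite (carrier G)"
    using prime_gt_0_nat[OF assms(1)] assms(2) by (simp flip: order_gt_0_iff_finite)
  have "carrier G \<noteq> {\<one>}"
  proof
    assume "carrier G = {\<one>}"
    then have "order G = 1" by (simp add: order_def)
    then show False using assms by (simp add: prime_nat_iff)
  qed
  then obtain x where x: "x \<in> carrier G" "x \<noteq> \<one>" using one_closed by blast
  have "ord x dvd p" "ord x \<noteq> 1"
    using ord_dvd_group_order[OF x(1)] ord_eq_1[OF x(1)] x(2) assms(2) by auto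
  then have ord: "ord x = p" using assms(1) by (auto simp: prime_nat_iff)
  have gsub: "generate G {x} \<subseteq> carrier G"
    using generate_incl[of "{x}"] x(1) by simp
  have "card (generate G {x}) = card (carrier G)"
    using generate_pow_card[OF x(1)] ord assms(2) by (simp add: order_def)
  then have "generate G {x} = carrier G"
    by (rule card_subset_eq[OF fin gsub])
  moreover have "generate G {x} = range (\<lambda>i::int. x [^] i)"
    unfolding generate_pow[OF x(1)] by blast
  ultimately show ?thesis using that[OF x(1)] int_pow_eq[OF x(1)] ord by blast
qed

lemma image_preimage:
  assumes "h ` A = B" "M \<subseteq> B"
  shows "h ` {x \<in> A. h x \<in> M} = M"
  using assms by blast

text \<open>
  Both groups are cyclic with the same relation between exponents, so sending the powers of one
  generator to the powers of the other is well defined.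
\<close>

lemma prime_order_epi:
  assumes H: "group H" "order H = p" and K: "group K" "order K = p" and p: "prime p"
  shows "epi H K \<noteq> {}"
proof -
  obtain x where x: "x \<in> carrier H" "\<And>i j::int. x [^]\<^bsub>H\<^esub> i = x [^]\<^bsub>H\<^esub> j \<longleftrightarrow> int p dvd j - i"
      "carrier H = range (\<lambda>i::int. x [^]\<^bsub>H\<^esub> i)"
    using group.prime_order_generator[OF H(1) p H(2)] by blast
  obtain y where y: "y \<in> carrier K" "\<And>i j::int. y [^]\<^bsub>K\<^esub> i = y [^]\<^bsub>K\<^esub> j \<longleftrightarrow> int p dvd j - i"
      "carrier K = range (\<lambda>i::int. y [^]\<^bsub>K\<^esub> i)"
    using group.prime_order_generator[OF K(1) p K(2)] by blast
  define f where "f a = y [^]\<^bsub>K\<^esub> (SOME i::int. x [^]\<^bsub>H\<^esub> i = a)" for a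
  have f: "f (x [^]\<^bsub>H\<^esub> i) = y [^]\<^bsub>K\<^esub> i" for i :: int
  proof -
    have "x [^]\<^bsub>H\<^esub> (SOME j::int. x [^]\<^bsub>H\<^esub> j = x [^]\<^bsub>H\<^esub> i) = x [^]\<^bsub>H\<^esub> i"
      by (rule someI) (rule refl)
    then show ?thesis unfolding f_def using x(2) y(2) by simp
  qed
  have "f \<in> epi H K"
    unfolding epi_def
  proof (intro CollectI conjI homI)
    show "f a \<in> carrier K" if "a \<in> carrier H" for a
      using that f x(3) y(3) by auto
    show "f (a \<otimes>\<^bsub>H\<^esub> b) = f a \<otimes>\<^bsub>K\<^esub> f b" if ab: "a \<in> carrier H" "b \<in> carrier H" for a b
    proof -
      obtain i j :: int where ij: "a = x [^]\<^bsub>H\<^esub> i" "b = x [^]\<^bsub>H\<^esub> j" using ab x(3) by auto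
      have "a \<otimes>\<^bsub>H\<^esub> b = x [^]\<^bsub>H\<^esub> (i + j)" using ij group.int_pow_mult[OF H(1) x(1)] by simp
      then show ?thesis using ij f group.int_pow_mult[OF K(1) y(1)] by simp
    qed
    show "f ` carrier H = carrier K"
      using f by (simp add: x(3) y(3) image_image)
  qed
  then show ?thesis by blast
qed

text \<open>
  The step by which a normal \<open>\<XX>\<close>-subgroup \<open>H\<close> is enlarged: an \<open>\<XX>\<close>-subgroup of the quotient by \<open>H\<close>
  pulls back to an \<open>\<XX>\<close>-subgroup containing \<open>H\<close>.
\<close>

lemma (in normal) in_class_preimage:
  assumes \<XX>: "complete_class \<XX>" and fin: "finite (carrier G)"
    and H: "in_class \<XX> (G\<lparr>carrier := H\<rparr>)"
    and M: "subgroup M (G Mod H)" "in_class \<XX> ((G Mod H)\<lparr>carrier := M\<rparr>)"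
  shows "in_class \<XX> (G\<lparr>carrier := {x \<in> carrier G. H #> x \<in> M}\<rparr>)"
proof (rule in_class_extension[OF \<XX> _ _ factorgroup_is_group])
  let ?\<pi> = "\<lambda>x. H #> x"
  let ?E = "{x \<in> carrier G. ?\<pi> x \<in> M}"
  interpret \<pi>: group_hom G "G Mod H" ?\<pi> by (rule quotient_hom)
  have E: "subgroup ?E G" by (rule \<pi>.preimage_subgroup[OF M(1)])
  show "group (G\<lparr>carrier := ?E\<rparr>)" by (rule subgroup_imp_group[OF E])
  show "finite (carrier (G\<lparr>carrier := ?E\<rparr>))" using fin by simp
  show "?\<pi> \<in> hom (G\<lparr>carrier := ?E\<rparr>) (G Mod H)"
    using group_hom.homh[OF \<pi>.induced_group_hom'[OF E]] .
  have "H \<subseteq> ?E"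
    using rcos_const[OF is_group] subset subgroup.one_closed[OF M(1)] by auto
  then have "kernel (G\<lparr>carrier := ?E\<rparr>) (G Mod H) ?\<pi> = H"
    using quotient_kernel unfolding kernel_def by auto
  then show "in_class \<XX> (G\<lparr>carrier := ?E, carrier := kernel (G\<lparr>carrier := ?E\<rparr>) (G Mod H) ?\<pi>\<rparr>)"
    using H by simp
  show "in_class \<XX> ((G Mod H)\<lparr>carrier := ?\<pi> ` carrier (G\<lparr>carrier := ?E\<rparr>)\<rparr>)"
    using image_preimage[OF quotient_surj subgroup.subset[OF M(1)]] M(2) by simp
qed

text \<open>
  A complete class is closed under extensions, hence contains all \<open>p\<close>-groups as soon as it contains
  the group of order \<open>p\<close>; this one occurs inside any member of order divisible by \<open>p\<close>. Climbing from
  a maximal normal \<open>\<XX>\<close>-subgroup by a normal subgroup of order \<open>p\<close> of the quotient replaces an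
  induction over groups of varying types.
\<close>

lemma (in group) p_group_in_class:
  assumes \<XX>: "complete_class \<XX>" and C: "group C" "in_class \<XX> C" "finite (carrier C)"
    and p: "prime p" "p dvd order C" and G: "order G = p ^ n"
  shows "in_class \<XX> G"
proof -
  have fin: "finite (carrier G)"
    using G p(1) by (simp add: prime_gt_0_nat flip: order_gt_0_iff_finite)
  have prime_order: "in_class \<XX> Q" if Q: "group Q" "order Q = p" for Q :: "'a set monoid"
  proof -
    obtain P where P: "subgroup P C" "card P = p"
      using group.subgroup_of_prime_order[OF C(1) p C(3)] .
    have grP: "group (C\<lparr>carrier := P\<rparr>)" by (rule group.subgroup_imp_group[OF C(1) P(1)])
    obtain f where f: "f \<in> epi (C\<lparr>carrier := P\<rparr>) Q"
      using prime_order_epi[OF grP _ Q p(1)] P(2) by (auto simp: order_def)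
    show ?thesis
      by (rule in_class_epi[OF \<XX> grP in_class_subgroup[OF \<XX> C(1,2) P(1)] Q(1) f])
  qed
  let ?F = "{D. D \<lhd> G \<and> in_class \<XX> (G\<lparr>carrier := D\<rparr>)}"
  have one: "{\<one>} \<in> ?F" using one_is_normal trivial_in_class[OF \<XX> C(1,2)] by blast
  have sub: "D \<subseteq> carrier G" if "D \<in> ?F" for D
    using that normal_imp_subgroup subgroup.subset by blast
  have finF: "finite ?F" by (rule finite_subset[of _ "Pow (carrier G)"]) (use sub fin in auto)
  obtain D where D: "D \<in> ?F" "\<And>E. E \<in> ?F \<Longrightarrow> D \<subseteq> E \<Longrightarrow> D = E"
    using finite_has_maximal[OF finF] one by blast
  have DG: "D \<lhd> G" using D(1) by blast
  interpret D: normal D G by fact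
  let ?\<pi> = "\<lambda>x. D #> x"
  interpret \<pi>: group_hom G "G Mod D" ?\<pi> by (rule D.quotient_hom)
  have "order (G Mod D) * card D = p ^ n"
    using lagrange[OF D.subgroup_axioms] G by (simp add: order_def FactGroup_def)
  then have "order (G Mod D) dvd p ^ n" by (metis dvd_triv_left)
  then obtain k where k: "order (G Mod D) = p ^ k" using p(1) divides_primepow_nat by blast
  have "k = 0"
  proof (rule ccontr)
    assume "k \<noteq> 0"
    then obtain M where M: "M \<lhd> G Mod D" "card M = p"
      using \<pi>.H.p_group_normal_prime_order[OF p(1) k] by auto
    have sM: "subgroup M (G Mod D)" using M(1) by (rule normal_imp_subgroup)
    let ?E = "{x \<in> carrier G. ?\<pi> x \<in> M}"
    have E: "?E \<lhd> G" by (rule \<pi>.preimage_normal[OF M(1)])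
    have img: "?\<pi> ` ?E = M"
      by (rule image_preimage[OF D.quotient_surj subgroup.subset[OF sM]])
    have DE: "D \<subseteq> ?E"
      using D.rcos_const[OF is_group] D.subset subgroup.one_closed[OF sM] by auto
    have "group ((G Mod D)\<lparr>carrier := M\<rparr>)" by (rule \<pi>.H.subgroup_imp_group[OF sM])
    then have "in_class \<XX> ((G Mod D)\<lparr>carrier := M\<rparr>)"
      using prime_order M(2) by (simp add: order_def)
    then have "in_class \<XX> (G\<lparr>carrier := ?E\<rparr>)"
      using D.in_class_preimage[OF \<XX> fin _ sM] D(1) by blast
    then have "D = ?E" using D(2)[of ?E] E DE by blast
    then have "M = ?\<pi> ` D" using img by simp
    also have "\<dots> \<subseteq> {D}" using D.rcos_const[OF is_group] by auto
    finally have "card M \<le> 1" using card_mono[of "{D}" M] by simp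
    then show False using M(2) p(1) by (simp add: prime_nat_iff)
  qed
  then have "order (G Mod D) = 1" using k by simp
  then have "card D = order G"
    using lagrange[OF D.subgroup_axioms] by (simp add: order_def FactGroup_def)
  then have "D = carrier G" using card_subset_eq[OF fin D.subset] by (simp add: order_def)
  then show ?thesis using D(1) by simp
qed

section \<open>The Frattini argument\<close>

lemma set_multI: "h \<in> H \<Longrightarrow> k \<in> K \<Longrightarrow> h \<otimes>\<^bsub>G\<^esub> k \<in> H <#>\<^bsub>G\<^esub> K"
  unfolding set_mult_def by blast

context group
begin

lemma inv_cancel:
  assumes "x \<in> carrier G" "y \<in> carrier G"
  shows "x \<otimes> (inv x \<otimes> y) = y" "inv x \<otimes> (x \<otimes> y) = y"
  using assms by (simp_all flip: m_assoc)

lemma mem_normalizer_iff: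
  assumes "H \<subseteq> carrier G"
  shows "g \<in> normalizer G H \<longleftrightarrow> g \<in> carrier G \<and> subgroup_conj G g H = H"
  using assms by (simp add: normalizer_def stabilizer_def subgroup_conj_def)

lemma normalizer_memI:
  assumes H: "subgroup H G" "finite H" and g: "g \<in> carrier G"
    and conj: "\<And>x. x \<in> H \<Longrightarrow> g \<otimes> x \<otimes> inv g \<in> H"
  shows "g \<in> normalizer G H"
proof -
  have HG: "H \<subseteq> carrier G" using H(1) by (rule subgroup.subset)
  have "inj_on (\<lambda>x. g \<otimes> x \<otimes> inv g) H"
    by (rule inj_onI) (use g HG in \<open>simp add: subset_iff\<close>)
  then have "card (subgroup_conj G g H) = card H"
    unfolding subgroup_conj_image by (rule card_image)
  moreover have "subgroup_conj G g H \<subseteq> H" unfolding subgroup_conj_image using conj by blast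
  ultimately have "subgroup_conj G g H = H" using H(2) by (simp add: card_subset_eq)
  then show ?thesis using mem_normalizer_iff[OF HG] g by blast
qed

text \<open>
  The Frattini argument. For \<open>g\<close> in the whole group, the conjugate of \<open>P\<close> by \<open>g\<close> acts by right
  translation on the cosets of \<open>P\<close> in \<open>N\<close>, whose number is prime to \<open>p\<close>. A fixed coset
  \<open>P #> y\<close> says that \<open>y \<otimes> g\<close> normalizes \<open>P\<close>. Conjugacy of the Sylow subgroups of \<open>N\<close> is thus
  obtained only in the form in which it is needed.
\<close>

lemma frattini:
  assumes fin: "finite (carrier G)" and N: "N \<lhd> G"
    and P: "subgroup P G" "P \<subseteq> N" and p: "prime p" "card P = p ^ n" "\<not> p dvd card N div p ^ n"
  shows "N <#> normalizer G P = carrier G"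
proof
  have sN: "subgroup N G" using N by (rule normal_imp_subgroup)
  have PG: "P \<subseteq> carrier G" and NG: "N \<subseteq> carrier G"
    using P(1) sN by (simp_all add: subgroup.subset)
  show "N <#> normalizer G P \<subseteq> carrier G"
    using setmult_subset_G[OF NG] mem_normalizer_iff[OF PG] by blast
  show "carrier G \<subseteq> N <#> normalizer G P"
  proof
    fix g assume g: "g \<in> carrier G"
    let ?E = "{P #> y | y. y \<in> N}"
    let ?act = "\<lambda>x C. C #> (g \<otimes> inv x \<otimes> inv g)"
    have PN: "subgroup P (G\<lparr>carrier := N\<rparr>)" using subgroup_incl[OF P(1) sN P(2)] .
    have "?E = rcosets\<^bsub>G\<lparr>carrier := N\<rparr>\<^esub> P" by (auto simp: RCOSETS_def)
    then have cardN: "card ?E * p ^ n = card N"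
      using group.lagrange[OF subgroup_imp_group[OF sN] PN] p(2) by (simp add: order_def)
    then have "card N div p ^ n = card ?E" 
      using prime_gt_0_nat[OF p(1)] by (simp flip: cardN)
    then have E: "\<not> p dvd card ?E" using p(3) by simp
    \<comment> \<open>The inverse of x turns right translation into a left action.\<close>
    have conjN: "g \<otimes> inv x \<otimes> inv g \<in> N" if "x \<in> P" for x
      using normal_conj[OF N g, of "inv x"] that P(2) subgroup.m_inv_closed[OF sN] by blast
    have "\<exists>C\<in>?E. \<forall>x\<in>carrier (G\<lparr>carrier := P\<rparr>). ?act x C = C"
    proof (rule p_group_fixed_point[OF _ p(1) _ _ E])
      show "group (G\<lparr>carrier := P\<rparr>)" by (rule subgroup_imp_group[OF P(1)])
      show "order (G\<lparr>carrier := P\<rparr>) = p ^ n" using p(2) by (simp add: order_def)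
      have "finite N" using fin NG finite_subset by blast
      then show "finite ?E" by simp
    next
      fix x C assume "x \<in> carrier (G\<lparr>carrier := P\<rparr>)" "C \<in> ?E"
      then obtain y where y: "y \<in> N" "C = P #> y" and x: "x \<in> P" by auto
      have "?act x C = P #> (y \<otimes> (g \<otimes> inv x \<otimes> inv g))"
        unfolding y(2) by (rule coset_mult_assoc[OF PG]) (use y(1) conjN[OF x] NG in blast)+
      then show "?act x C \<in> ?E"
        using subgroup.m_closed[OF sN y(1) conjN[OF x]] by blast
    next
      fix C assume "C \<in> ?E"
      then obtain y where "y \<in> N" "C = P #> y" by blast
      then have "C \<subseteq> carrier G" using NG PG r_coset_subset_G by blast
      then show "?act \<one>\<^bsub>G\<lparr>carrier := P\<rparr>\<^esub> C = C" using g by simp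
    next
      fix x z C assume xz: "x \<in> carrier (G\<lparr>carrier := P\<rparr>)" "z \<in> carrier (G\<lparr>carrier := P\<rparr>)"
        and "C \<in> ?E"
      then obtain y where "y \<in> N" "C = P #> y" by blast
      then have CG: "C \<subseteq> carrier G" using NG PG r_coset_subset_G by blast
      have c: "x \<in> carrier G" "z \<in> carrier G" using xz PG by auto
      have "?act x (?act z C) = C #> (g \<otimes> inv z \<otimes> inv g \<otimes> (g \<otimes> inv x \<otimes> inv g))"
        using CG c g by (simp add: coset_mult_assoc)
      also have "g \<otimes> inv z \<otimes> inv g \<otimes> (g \<otimes> inv x \<otimes> inv g) = g \<otimes> inv (x \<otimes> z) \<otimes> inv g"
        using c g by (simp add: m_assoc inv_mult_group inv_cancel)
      finally show "?act x (?act z C) = ?act (x \<otimes>\<^bsub>G\<lparr>carrier := P\<rparr>\<^esub> z) C" by simp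
    qed
    then obtain y where y: "y \<in> N" and fixed: "\<And>x. x \<in> P \<Longrightarrow> ?act x (P #> y) = P #> y"
      by auto
    have yG: "y \<in> carrier G" using y NG by blast
    have "y \<otimes> g \<in> normalizer G P"
    proof (rule normalizer_memI[OF P(1)])
      show "finite P" using PG fin finite_subset by blast
      show "y \<otimes> g \<in> carrier G" using yG g by simp
      fix x assume x: "x \<in> P"
      then have xG: "x \<in> carrier G" using PG by blast
      have ix: "inv x \<in> P" using subgroup.m_inv_closed[OF P(1) x] .
      have "y \<otimes> (g \<otimes> x \<otimes> inv g) \<in> P #> (y \<otimes> (g \<otimes> x \<otimes> inv g))"
        using rcos_self[OF _ P(1)] yG g xG by simp
      also have "\<dots> = P #> y"
        using fixed[OF ix] xG g yG PG by (simp add: coset_mult_assoc)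
      finally have "y \<otimes> (g \<otimes> x \<otimes> inv g) \<otimes> inv y \<in> P"
        using subgroup.rcos_module_imp[OF P(1) is_group yG] by blast
      then show "y \<otimes> g \<otimes> x \<otimes> inv (y \<otimes> g) \<in> P"
        using yG g xG by (simp add: m_assoc inv_mult_group)
    qed
    then have "inv y \<otimes> (y \<otimes> g) \<in> N <#> normalizer G P"
      by (rule set_multI[OF subgroup.m_inv_closed[OF sN y]])
    then show "g \<in> N <#> normalizer G P" using yG g by (simp add: inv_cancel)
  qed
qed

end

section \<open>Proper supplements of normal Sylow subgroups\<close>

lemma (in comm_group) hom_finprod_self:
  assumes "h \<in> hom G G" "f \<in> E \<rightarrow> carrier G"
  shows "h (finprod G f E) = finprod G (\<lambda>x. h (f x)) E"
  using assms(2)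
proof (induction E rule: infinite_finite_induct)
  case (infinite E)
  then show ?case using hom_one[OF assms(1)] is_group by simp
next
  case empty
  then show ?case using hom_one[OF assms(1)] is_group by simp
next
  case (insert x E)
  then have "f x \<in> carrier G" "f \<in> E \<rightarrow> carrier G" by auto
  moreover have "(\<lambda>x. h (f x)) \<in> E \<rightarrow> carrier G" "h (f x) \<in> carrier G"
    using calculation hom_in_carrier[OF assms(1)] by auto
  ultimately show ?case
    using insert hom_mult[OF assms(1)] by simp
qed

lemma (in normal) l_coset_closed:
  assumes "g \<in> carrier G" "C \<in> rcosets H"
  shows "g <# C \<in> rcosets H"
proof -
  obtain x where x: "x \<in> carrier G" "C = H #> x" using assms(2) by (auto simp: RCOSETS_def)
  then have "g <# C = (g \<otimes> x) <# H"
    using assms(1) subset coset_eq by (simp add: lcos_m_assoc)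
  also have "\<dots> = H #> (g \<otimes> x)" using assms(1) x coset_eq by simp
  finally show ?thesis using assms(1) x(1) by (auto simp: RCOSETS_def)
qed

lemma (in group) pow_inverse_coprime:
  assumes "coprime m (order G)" "m > 0" "finite (carrier G)"
  obtains k where "\<And>a. a \<in> carrier G \<Longrightarrow> (a [^] (k::nat)) [^] (m::nat) = a"
    "\<And>a. a \<in> carrier G \<Longrightarrow> (a [^] m) [^] k = a"
proof -
  \<comment> \<open>Bezout: k inverts m modulo the group order.\<close>
  obtain k y where ky: "m * k = order G * y + 1"
    using bezout_nat[of m "order G"] assms(1,2) by auto
  have eq: "a [^] (m * k) = a" if "a \<in> carrier G" for a
  proof -
    have "a [^] (m * k) = (a [^] order G) [^] y \<otimes> a [^] (1::nat)"
      using that by (simp add: ky nat_pow_pow flip: nat_pow_mult)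
    then show ?thesis using that by (simp add: pow_order_eq_1)
  qed
  show ?thesis by (rule that[of k]) (use eq in \<open>simp_all add: nat_pow_pow mult.commute\<close>)
qed

text \<open>
  The averaging argument behind the Schur-Zassenhaus theorem for an abelian normal subgroup \<open>H\<close>.
  Choose a representative \<open>r C\<close> of every coset \<open>C\<close>. Left translation by \<open>g\<close> moves the
  representatives away from the chosen ones; multiplying up the discrepancies, which lie in \<open>H\<close>,
  gives a map \<open>c\<close> into \<open>H\<close> with \<open>c (g \<otimes> h) = g \<otimes> c h \<otimes> inv g \<otimes> c g\<close>. On \<open>H\<close> itself
  \<open>c\<close> is the power map whose exponent is the index of \<open>H\<close>, and this is bijective by coprimality.
  Hence the elements with trivial \<open>c\<close> form a proper subgroup that meets every coset of \<open>H\<close>.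
\<close>

lemma (in normal) abelian_coprime_proper_supplement:
  assumes fin: "finite (carrier G)"
    and comm: "\<And>a b. a \<in> H \<Longrightarrow> b \<in> H \<Longrightarrow> a \<otimes> b = b \<otimes> a"
    and nontriv: "H \<noteq> {\<one>}" and cop: "coprime (card (rcosets H)) (card H)"
  obtains T where "subgroup T G" "T \<noteq> carrier G" "H <#> T = carrier G"
proof -
  let ?H = "G\<lparr>carrier := H\<rparr>"
  let ?E = "rcosets H"
  let ?m = "card ?E"
  have "group ?H" by (rule subgroup_imp_group[OF subgroup_axioms])
  then interpret H: comm_group ?H
    by (rule group.group_comm_groupI) (use comm in simp)
  have finE: "finite ?E" by (simp add: RCOSETS_def fin)
  have EG: "C \<subseteq> carrier G" if "C \<in> ?E" for C using that rcosets_carrier[OF is_group] by blast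
  define r where "r C = (SOME x. x \<in> C)" for C :: "'a set"
  have r: "r C \<in> carrier G" "C = H #> r C" if C: "C \<in> ?E" for C
  proof -
    have "r C \<in> C" unfolding r_def
      using rcosets_non_empty[OF C] by (simp add: some_in_eq)
    then show rG: "r C \<in> carrier G" using EG[OF C] by blast
    obtain x where "x \<in> carrier G" "C = H #> x" using C by (auto simp: RCOSETS_def)
    then show "C = H #> r C" using \<open>r C \<in> C\<close> repr_independence subgroup_axioms by blast
  qed
  define f where "f g C = g \<otimes> r (inv g <# C) \<otimes> inv (r C)" for g C
  define c where "c g = finprod ?H (f g) ?E" for g
  have fH: "f g C \<in> H" if g: "g \<in> carrier G" and C: "C \<in> ?E" for g C
  proof -
    have igC: "inv g <# C \<in> ?E" using l_coset_closed C g by simp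
    have "inv g <# C = (inv g \<otimes> r C) <# H"
      using r[OF C] coset_eq g subset by (metis inv_closed lcos_m_assoc)
    then have "r (inv g <# C) \<in> (inv g \<otimes> r C) <# H"
      using rcos_self[OF r(1)[OF igC] subgroup_axioms] r(2)[OF igC] by simp
    then obtain a where a: "a \<in> H" "r (inv g <# C) = inv g \<otimes> r C \<otimes> a"
      unfolding l_coset_def by blast
    then have "f g C = r C \<otimes> a \<otimes> inv (r C)"
      unfolding f_def using g r(1)[OF C] by (simp add: m_assoc inv_cancel)
    then show ?thesis using inv_op_closed2[OF r(1)[OF C] a(1)] by simp
  qed
  have cH: "c g \<in> H" if "g \<in> carrier G" for g
    using H.finprod_closed[of "f g" ?E] fH[OF that] unfolding c_def by auto
  have conj_hom: "(\<lambda>a. g \<otimes> a \<otimes> inv g) \<in> hom ?H ?H" if g: "g \<in> carrier G" for g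
  proof (rule homI)
    fix a b assume ab: "a \<in> carrier ?H" "b \<in> carrier ?H"
    then have "a \<in> carrier G" "b \<in> carrier G" by auto
    then have "g \<otimes> (a \<otimes> b) \<otimes> inv g = (g \<otimes> a \<otimes> inv g) \<otimes> (g \<otimes> b \<otimes> inv g)"
      using g by (simp add: m_assoc inv_cancel)
    then show "g \<otimes> (a \<otimes>\<^bsub>?H\<^esub> b) \<otimes> inv g = (g \<otimes> a \<otimes> inv g) \<otimes>\<^bsub>?H\<^esub> (g \<otimes> b \<otimes> inv g)" by simp
  qed (use g inv_op_closed2 in simp)
  have crossed: "c (g \<otimes> h) = g \<otimes> c h \<otimes> inv g \<otimes> c g"
    if g: "g \<in> carrier G" and h: "h \<in> carrier G" for g h
  proof -
    let ?s = "\<lambda>C. inv g <# C"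
    have s: "?s C \<in> ?E" if "C \<in> ?E" for C using l_coset_closed that g by simp
    have "inj_on ?s ?E"
    proof (rule inj_onI)
      fix C D assume "C \<in> ?E" "D \<in> ?E" "?s C = ?s D"
      moreover have "g <# ?s X = X" if "X \<in> ?E" for X
        using EG[OF that] g by (simp add: lcos_m_assoc lcos_mult_one)
      ultimately show "C = D" by metis
    qed
    then have sE: "inj_on ?s ?E" "?s ` ?E = ?E"
      using endo_inj_surj[OF finE] s by blast+
    have split: "f (g \<otimes> h) C = g \<otimes> f h (?s C) \<otimes> inv g \<otimes> f g C" if C: "C \<in> ?E" for C
    proof -
      have "inv (g \<otimes> h) <# C = inv h <# ?s C"
        using g h EG[OF C] by (simp add: lcos_m_assoc inv_mult_group)
      moreover have "inv h <# ?s C \<in> ?E" using l_coset_closed s[OF C] h by simp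
      ultimately show ?thesis
        unfolding f_def using g h r(1)[OF C] r(1)[OF s[OF C]] r(1)[of "inv h <# ?s C"]
        by (simp add: m_assoc inv_cancel)
    qed
    have mem: "f h \<in> ?E \<rightarrow> carrier ?H" "f g \<in> ?E \<rightarrow> carrier ?H"
      "(\<lambda>C. g \<otimes> f h (?s C) \<otimes> inv g) \<in> ?E \<rightarrow> carrier ?H"
      using fH g h s inv_op_closed2 by auto
    have "c (g \<otimes> h) = finprod ?H (\<lambda>C. (g \<otimes> f h (?s C) \<otimes> inv g) \<otimes>\<^bsub>?H\<^esub> f g C) ?E"
      unfolding c_def by (rule H.finprod_cong') (use split mem inv_op_closed2 in auto)
    also have "\<dots> = finprod ?H (\<lambda>C. g \<otimes> f h (?s C) \<otimes> inv g) ?E \<otimes> c g"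
      unfolding c_def using H.finprod_multf[OF mem(3,2)] by simp
    also have "finprod ?H (\<lambda>C. g \<otimes> f h (?s C) \<otimes> inv g) ?E
        = g \<otimes> finprod ?H (\<lambda>C. f h (?s C)) ?E \<otimes> inv g"
      by (rule H.hom_finprod_self[OF conj_hom[OF g], symmetric]) (use fH[OF h] s in auto)
    also have "finprod ?H (\<lambda>C. f h (?s C)) ?E = c h"
      unfolding c_def using H.finprod_reindex[of "f h" ?s ?E] mem(1) sE by simp
    finally show ?thesis .
  qed
  have c_pow: "c a = a [^] ?m" if a: "a \<in> H" for a
  proof -
    have "f a C = a" if C: "C \<in> ?E" for C
    proof -
      have "inv a <# H = H" using coset_eq rcos_const[OF is_group, of "inv a"] a by simp
      then have "inv a <# C = C"
        using coset_assoc[OF _ r(1)[OF C] subset, of "inv a"] r(2)[OF C] a by simp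
      then show ?thesis unfolding f_def using a r(1)[OF C] by (simp add: m_assoc)
    qed
    then have "c a = finprod ?H (\<lambda>_. a) ?E"
      unfolding c_def by (intro H.finprod_cong') (use a in auto)
    also have "\<dots> = a [^]\<^bsub>?H\<^esub> ?m" using H.finprod_const a by simp
    finally show ?thesis by (simp flip: nat_pow_consistent)
  qed
  have "?E \<noteq> {}" using rcosetsI[OF subset one_closed] by blast
  then have m0: "?m > 0" using finE by (simp add: card_gt_0_iff)
  have finH: "finite H" using fin subset finite_subset by blast
  obtain k where k: "\<And>a. a \<in> H \<Longrightarrow> (a [^] (k::nat)) [^] ?m = a"
    "\<And>a. a \<in> H \<Longrightarrow> (a [^] ?m) [^] k = a"
    using H.pow_inverse_coprime[of ?m] cop m0 finH
    by (auto simp: order_def simp flip: nat_pow_consistent)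
  let ?T = "{g \<in> carrier G. c g = \<one>}"
  have c1: "c \<one> = \<one>" using c_pow[OF subgroup.one_closed[OF subgroup_axioms]] by simp
  have "subgroup ?T G"
  proof (rule subgroupI)
    show "?T \<noteq> {}" using c1 by blast
  next
    fix g assume g: "g \<in> ?T"
    then have "c (inv g \<otimes> g) = c (inv g)"
      using crossed[of "inv g" g] cH[of "inv g"] by simp
    then show "inv g \<in> ?T" using g c1 by simp
  next
    fix g h assume "g \<in> ?T" "h \<in> ?T"
    then show "g \<otimes> h \<in> ?T" using crossed[of g h] by simp
  qed blast
  moreover have "?T \<noteq> carrier G"
  proof
    assume T: "?T = carrier G"
    obtain a where a: "a \<in> H" "a \<noteq> \<one>" using nontriv subgroup.one_closed[OF subgroup_axioms] by blast
    then have "a \<in> ?T" using T subset by blast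
    then have "a [^] ?m = \<one>" using c_pow[OF a(1)] by simp
    then show False using k(2)[OF a(1)] a(2) by simp
  qed
  moreover have "H <#> ?T = carrier G"
  proof
    show "H <#> ?T \<subseteq> carrier G" by (rule setmult_subset_G[OF subset]) blast
    show "carrier G \<subseteq> H <#> ?T"
    proof
      fix g assume g: "g \<in> carrier G"
      \<comment> \<open>Since c n is the power of n by the index, this n satisfies c n = inv (c g).\<close>
      define n where "n = inv (c g) [^] k"
      have icg: "inv (c g) \<in> H" using cH[OF g] by simp
      then have n: "n \<in> H" unfolding n_def
        using H.nat_pow_closed[of "inv (c g)" k] by (simp add: nat_pow_consistent[of _ _ H])
      have "c n = inv (c g)" using c_pow[OF n] k(1)[OF icg] unfolding n_def by simp
      then have "c (n \<otimes> g) = n \<otimes> c g \<otimes> inv n \<otimes> inv (c g)"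
        using crossed[of n g] n g by simp
      also have "\<dots> = c g \<otimes> n \<otimes> inv n \<otimes> inv (c g)" by (simp only: comm[OF n cH[OF g]])
      also have "\<dots> = \<one>" using n cH[OF g] by (simp add: m_assoc inv_cancel)
      finally have "n \<otimes> g \<in> ?T" using n g by simp
      with n have "inv n \<otimes> (n \<otimes> g) \<in> H <#> ?T" by (intro set_multI) simp_all
      then show "g \<in> H <#> ?T" using n g by (simp add: inv_cancel)
    qed
  qed
  ultimately show ?thesis using that by blast
qed

lemma (in group) subgroup_card_dvd:
  assumes "subgroup A G" "subgroup B G" "A \<subseteq> B"
  shows "card A dvd card B"
proof -
  have "card (rcosets\<^bsub>G\<lparr>carrier := B\<rparr>\<^esub> A) * card A = order (G\<lparr>carrier := B\<rparr>)"
    by (rule group.lagrange[OF subgroup_imp_group[OF assms(2)] subgroup_incl[OF assms]])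
  also have "\<dots> = card B" by (simp add: order_def)
  finally show ?thesis by (rule dvdI[OF trans[OF sym mult.commute]])
qed

lemma (in group) center_of_normal_subgroup:
  assumes A: "A \<lhd> G"
  shows "center (G\<lparr>carrier := A\<rparr>) \<lhd> G"
proof (rule normal_subgroupI)
  let ?Z = "center (G\<lparr>carrier := A\<rparr>)"
  have sA: "subgroup A G" using A by (rule normal_imp_subgroup)
  have AG: "A \<subseteq> carrier G" using sA by (rule subgroup.subset)
  show "subgroup ?Z G"
    using incl_subgroup[OF sA group.center_subgroup[OF subgroup_imp_group[OF sA]]] .
  fix g z assume g: "g \<in> carrier G" and z: "z \<in> ?Z"
  let ?c = "\<lambda>x. g \<otimes> x \<otimes> inv g"
  have mult: "?c (x \<otimes> y) = ?c x \<otimes> ?c y" if "x \<in> carrier G" "y \<in> carrier G" for x y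
    using that g by (simp add: m_assoc inv_cancel)
  have zA: "z \<in> A" "z \<in> carrier G" using z AG unfolding center_def by auto
  have "a \<otimes> ?c z = ?c z \<otimes> a" if a: "a \<in> A" for a
  proof -
    have aG: "a \<in> carrier G" using a AG by blast
    define b where "b = inv g \<otimes> a \<otimes> g"
    have b: "b \<in> A" unfolding b_def
      using normal_conj[OF A inv_closed[OF g] a] g by simp
    have bG: "b \<in> carrier G" using b AG by blast
    have ab: "a = ?c b" unfolding b_def
      using aG g by (simp add: m_assoc inv_cancel)
    have "b \<otimes> z = z \<otimes> b" using z b unfolding center_def by simp
    then show ?thesis
      unfolding ab mult[OF bG zA(2), symmetric] mult[OF zA(2) bG, symmetric] by simp
  qed
  moreover have "?c z \<in> A" using normal_conj[OF A g zA(1)] .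
  ultimately show "?c z \<in> ?Z" unfolding center_def by simp
qed

text \<open>
  A normal Sylow subgroup \<open>P\<close> need not be abelian, but its quotient by a maximal smaller normal
  subgroup \<open>D\<close> of the whole group is: the center of \<open>P\<close> modulo \<open>D\<close> is nontrivial and normal, so
  it is everything. A proper supplement modulo \<open>D\<close> pulls back to one of \<open>P\<close>. A proper supplement
  suffices below, so no induction towards a full complement is made.
\<close>

lemma (in group) normal_sylow_proper_supplement:
  assumes fin: "finite (carrier G)" and P: "P \<lhd> G"
    and p: "prime p" "card P = p ^ n" "n > 0" "\<not> p dvd card (rcosets P)"
  obtains T where "subgroup T G" "T \<noteq> carrier G" "P <#> T = carrier G"
proof -
  have sP: "subgroup P G" using P by (rule normal_imp_subgroup)
  have PG: "P \<subseteq> carrier G" using sP by (rule subgroup.subset)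
  let ?F = "{D. D \<lhd> G \<and> D \<subset> P}"
  have finF: "finite ?F" by (rule finite_subset[of _ "Pow (carrier G)"]) (use PG fin in auto)
  have "1 < p ^ n" using prime_gt_1_nat[OF p(1)] p(3) by (rule one_less_power)
  then have "P \<noteq> {\<one>}" using p(2) by auto
  then have "{\<one>} \<in> ?F" using one_is_normal subgroup.one_closed[OF sP] by blast
  then have "?F \<noteq> {}" by (rule ex_in_conv[THEN iffD1, OF exI])
  then obtain D where D: "D \<in> ?F" "\<forall>E\<in>?F. D \<subseteq> E \<longrightarrow> D = E"
    by (rule bexE[OF finite_has_maximal[OF finF]])
  have DG: "D \<lhd> G" and DP: "D \<subset> P" using D(1) by blast+
  interpret D: normal D G by fact
  let ?Q = "G Mod D"
  let ?\<pi> = "\<lambda>x. D #> x"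
  interpret \<pi>: group_hom G ?Q ?\<pi> by (rule D.quotient_hom)
  define A where "A = ?\<pi> ` P"
  have AQ: "A \<lhd> ?Q" unfolding A_def
    using normal.surj_hom_normal_subgroup[OF P \<pi>.group_hom_axioms D.quotient_surj] .
  have sA: "subgroup A ?Q" using AQ by (rule normal_imp_subgroup)
  have in_P: "x \<in> P" if x: "x \<in> carrier G" "?\<pi> x \<in> A" for x
  proof -
    obtain y where y: "y \<in> P" "D #> x = D #> y" using x(2) unfolding A_def by blast
    have "x \<in> D #> y" using rcos_self[OF x(1) D.subgroup_axioms] y(2) by simp
    then have "x \<otimes> inv y \<in> P" using D.rcos_module_imp[OF is_group] y(1) PG DP by blast
    then have "x \<otimes> inv y \<otimes> y \<in> P" using subgroup.m_closed[OF sP] y(1) by blast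
    then show ?thesis using x(1) y(1) PG by (auto simp: m_assoc)
  qed
  have finQ: "finite (carrier ?Q)" using fin by (simp add: carrier_FactGroup)
  have finA: "finite A" unfolding A_def using PG fin finite_subset by blast
  have cardA: "card A * card D = p ^ n"
  proof -
    interpret \<pi>P: group_hom "G\<lparr>carrier := P\<rparr>" ?Q ?\<pi> by (rule \<pi>.induced_group_hom'[OF sP])
    have "kernel (G\<lparr>carrier := P\<rparr>) ?Q ?\<pi> = D"
      using D.quotient_kernel DP PG unfolding kernel_def by auto
    then show ?thesis using \<pi>P.card_image_kernel p(2) by (simp add: A_def order_def)
  qed
  then have "card A dvd p ^ n" by (rule dvdI[OF sym])
  then obtain k where k: "card A = p ^ k" using p(1) divides_primepow_nat by blast
  have "k \<noteq> 0"
  proof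
    assume "k = 0"
    then have "card D = card P" using cardA k p(2) by simp
    then show False using psubset_card_mono[OF finite_subset[OF PG fin] DP] by simp
  qed
  let ?A = "?Q\<lparr>carrier := A\<rparr>"
  have grA: "group ?A" by (rule \<pi>.H.subgroup_imp_group[OF sA])
  let ?Z = "center ?A"
  have ZA: "?Z \<subseteq> A" unfolding center_def by auto
  have Z: "?Z \<lhd> ?Q" by (rule \<pi>.H.center_of_normal_subgroup[OF AQ])
  have sZ: "subgroup ?Z ?Q" using Z by (rule normal_imp_subgroup)
  have En: "{x \<in> carrier G. ?\<pi> x \<in> ?Z} \<lhd> G" (is "?E \<lhd> G") by (rule \<pi>.preimage_normal[OF Z])
  have imgE: "?\<pi> ` ?E = ?Z"
    by (rule image_preimage[OF D.quotient_surj subgroup.subset[OF sZ]])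
  have "D \<subseteq> ?E"
    using D.rcos_const[OF is_group] D.subset subgroup.one_closed[OF sZ] by auto
  moreover have "D \<noteq> ?E"
  proof
    assume "D = ?E"
    then have "?Z \<subseteq> {D}" using imgE D.rcos_const[OF is_group] by auto
    moreover obtain z where "z \<in> carrier ?A" "z \<noteq> \<one>\<^bsub>?A\<^esub>"
      "\<And>g. g \<in> carrier ?A \<Longrightarrow> g \<otimes>\<^bsub>?A\<^esub> z = z \<otimes>\<^bsub>?A\<^esub> g"
      using group.p_group_center_nontrivial[OF grA p(1), of k] k \<open>k \<noteq> 0\<close>
      by (auto simp: order_def)
    ultimately show False unfolding center_def by auto
  qed
  moreover have EP: "?E \<subseteq> P" using in_P ZA by blast
  ultimately have "?E = P" using D(2) En by blast
  then have "A = ?Z" using imgE A_def by simp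
  then have comm: "a \<otimes>\<^bsub>?Q\<^esub> b = b \<otimes>\<^bsub>?Q\<^esub> a" if "a \<in> A" "b \<in> A" for a b
    using that unfolding center_def by auto
  have "1 < card A" using one_less_power[OF prime_gt_1_nat[OF p(1)]] k \<open>k \<noteq> 0\<close> by simp
  then have "A \<noteq> {\<one>\<^bsub>?Q\<^esub>}" by auto
  moreover have "card (rcosets\<^bsub>?Q\<^esub> A) = card (rcosets P)"
  proof -
    have "card (rcosets\<^bsub>?Q\<^esub> A) * card A = order ?Q" by (rule \<pi>.H.lagrange[OF sA])
    moreover have "order ?Q * card D = order G"
      using lagrange[OF D.subgroup_axioms] by (simp add: order_def FactGroup_def)
    moreover have "card (rcosets P) * card P = order G" by (rule lagrange[OF sP])
    ultimately have "card (rcosets\<^bsub>?Q\<^esub> A) * (card A * card D) = card (rcosets P) * p ^ n"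
      using p(2) by (metis mult.assoc)
    then show ?thesis using cardA prime_gt_0_nat[OF p(1)] by simp
  qed
  then have "coprime (card (rcosets\<^bsub>?Q\<^esub> A)) (card A)"
    using p(1,4) k by (simp add: coprime_commute prime_imp_coprime)
  ultimately obtain T where T: "subgroup T ?Q" "T \<noteq> carrier ?Q" "A <#>\<^bsub>?Q\<^esub> T = carrier ?Q"
    using normal.abelian_coprime_proper_supplement[OF AQ finQ comm] by blast
  let ?T = "{x \<in> carrier G. ?\<pi> x \<in> T}"
  have "?\<pi> ` ?T = T" by (rule image_preimage[OF D.quotient_surj subgroup.subset[OF T(1)]])
  then have "?T \<noteq> carrier G" using T(2) D.quotient_surj by auto
  moreover have "P <#> ?T = carrier G"
  proof
    show "P <#> ?T \<subseteq> carrier G" by (rule setmult_subset_G[OF PG]) blast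
    show "carrier G \<subseteq> P <#> ?T"
    proof
      fix x assume x: "x \<in> carrier G"
      then have "?\<pi> x \<in> A <#>\<^bsub>?Q\<^esub> T" using T(3) by (simp add: carrier_FactGroup)
      then obtain a t where at: "a \<in> A" "t \<in> T" "?\<pi> x = a \<otimes>\<^bsub>?Q\<^esub> t"
        unfolding set_mult_def by blast
      then obtain y where y: "y \<in> P" "a = ?\<pi> y" unfolding A_def by blast
      have yG: "y \<in> carrier G" using y PG by blast
      have tQ: "t \<in> carrier ?Q" using subgroup.mem_carrier[OF T(1) at(2)] .
      have "?\<pi> (inv y \<otimes> x) = inv\<^bsub>?Q\<^esub> ?\<pi> y \<otimes>\<^bsub>?Q\<^esub> ?\<pi> x"
        using \<pi>.hom_mult[of "inv y" x] \<pi>.hom_inv[OF yG] x yG by simp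
      also have "\<dots> = t" unfolding at(3) y(2)
        using \<pi>.H.inv_cancel(2)[OF \<pi>.hom_closed[OF yG] tQ] .
      finally have "inv y \<otimes> x \<in> ?T" using at(2) x yG by simp
      then have "y \<otimes> (inv y \<otimes> x) \<in> P <#> ?T" by (rule set_multI[OF y(1)])
      then show "x \<in> P <#> ?T" using x yG by (simp add: inv_cancel)
    qed
  qed
  ultimately show ?thesis using that \<pi>.preimage_subgroup[OF T(1)] by blast
qed

section \<open>Lifting along an epimorphism\<close>

lemma (in group_hom) supplement_image:
  assumes "T \<subseteq> carrier G" "N \<subseteq> kernel G H h" "N <#> T = carrier G"
  shows "h ` T = h ` carrier G"
proof
  show "h ` T \<subseteq> h ` carrier G" using assms(1) by blast
  show "h ` carrier G \<subseteq> h ` T"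
  proof
    fix y assume "y \<in> h ` carrier G"
    then obtain g where g: "g \<in> N <#> T" "y = h g" using assms(3) by blast
    then obtain n t where nt: "n \<in> N" "t \<in> T" "g = n \<otimes> t" unfolding set_mult_def by blast
    have n: "n \<in> carrier G" "h n = \<one>\<^bsub>H\<^esub>" using nt(1) assms(2) by (auto simp: kernel_def)
    have "t \<in> carrier G" using nt(2) assms(1) by blast
    then have "h g = h t" using nt(3) n by simp
    then show "y \<in> h ` T" using g(2) nt(2) by blast
  qed
qed

text \<open>
  Let \<open>N\<close> be the kernel. Minimality says that no proper subgroup supplements a subgroup of \<open>N\<close>. So the
  normalizer of a Sylow subgroup of \<open>N\<close> is the whole group by the Frattini argument, and a prime
  dividing the order of \<open>N\<close> divides the order of the image, as otherwise the corresponding normal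
  Sylow subgroup would have a proper supplement. Thus every Sylow subgroup of \<open>N\<close> is a normal
  \<open>\<XX>\<close>-subgroup. A maximal normal \<open>\<XX>\<close>-subgroup in \<open>N\<close> absorbs all of them and therefore equals \<open>N\<close>.
\<close>

lemma (in group_hom) minimal_cover_in_class:
  assumes \<XX>: "complete_class \<XX>" and fin: "finite (carrier G)" and H: "in_class \<XX> H"
    and surj: "h ` carrier G = carrier H"
    and minimal: "\<And>T. subgroup T G \<Longrightarrow> h ` T = carrier H \<Longrightarrow> T = carrier G"
  shows "in_class \<XX> G"
proof -
  define N where "N = kernel G H h"
  have N: "N \<lhd> G" unfolding N_def by (rule normal_kernel)
  have sN: "subgroup N G" using N by (rule normal_imp_subgroup)
  have NG: "N \<subseteq> carrier G" using sN by (rule subgroup.subset)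
  have finN: "finite N" using NG fin by (rule finite_subset)
  have finH: "finite (carrier H)" using fin surj by (metis finite_imageI)
  have no_supplement: "T = carrier G" if "subgroup T G" "M \<subseteq> N" "M <#> T = carrier G" for M T
    using minimal[OF that(1)] supplement_image[OF subgroup.subset[OF that(1)] _ that(3)] that(2) surj
    unfolding N_def by blast
  have sylow: "P \<lhd> G \<and> in_class \<XX> (G\<lparr>carrier := P\<rparr>)"
    if P: "subgroup P G" "P \<subseteq> N" and p: "prime p" "card P = p ^ n" "\<not> p dvd card N div p ^ n"
      and n: "n > 0" for P p n
  proof
    have PG: "P \<subseteq> carrier G" using P(1) by (rule subgroup.subset)
    have "normalizer G P = carrier G"
      using no_supplement[OF G.normalizer_imp_subgroup[OF PG] _ G.frattini[OF fin N P p]] by blast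
    then show Pn: "P \<lhd> G"
      using G.normal_subgroupI[OF P(1)] G.mem_normalizer_iff[OF PG] unfolding G.subgroup_conj_image
      by blast
    have "p dvd order H"
    proof (rule ccontr)
      assume ndvd: "\<not> p dvd order H"
      have "p ^ n dvd card N"
        using G.subgroup_card_dvd[OF P(1) sN P(2)] p(2) by simp
      then have "order H * (card N div p ^ n) * p ^ n = order H * card N" by (simp add: mult.assoc)
      also have "\<dots> = order G" using card_image_kernel surj by (simp add: N_def order_def)
      also have "\<dots> = card (rcosets P) * p ^ n" using G.lagrange[OF P(1)] p(2) by simp
      finally have "card (rcosets P) * p ^ n = order H * (card N div p ^ n) * p ^ n" by (rule sym)
      then have "card (rcosets P) = order H * (card N div p ^ n)"
        using prime_gt_0_nat[OF p(1)] by simp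
      then have "\<not> p dvd card (rcosets P)"
        using ndvd p(1,3) by (simp add: prime_dvd_mult_iff)
      then obtain T where "subgroup T G" "T \<noteq> carrier G" "P <#> T = carrier G"
        using G.normal_sylow_proper_supplement[OF fin Pn p(1,2) n] by blast
      then show False using no_supplement P(2) by blast
    qed
    then show "in_class \<XX> (G\<lparr>carrier := P\<rparr>)"
      using group.p_group_in_class[OF G.subgroup_imp_group[OF P(1)] \<XX> H.is_group H finH p(1)] p(2)
      by (simp add: order_def)
  qed
  let ?F = "{R. R \<lhd> G \<and> R \<subseteq> N \<and> in_class \<XX> (G\<lparr>carrier := R\<rparr>)}"
  have finF: "finite ?F" by (rule finite_subset[of _ "Pow N"]) (use finN in auto)
  have "{\<one>} \<in> ?F"
    using G.one_is_normal subgroup.one_closed[OF sN] G.trivial_in_class[OF \<XX> H.is_group H] by blast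
  then have "?F \<noteq> {}" by (rule ex_in_conv[THEN iffD1, OF exI])
  then obtain R where R: "R \<in> ?F" "\<forall>E\<in>?F. R \<subseteq> E \<longrightarrow> R = E"
    by (rule bexE[OF finite_has_maximal[OF finF]])
  have RG: "R \<lhd> G" and RN: "R \<subseteq> N" and RX: "in_class \<XX> (G\<lparr>carrier := R\<rparr>)" using R(1) by blast+
  interpret R: normal R G by fact
  let ?\<pi> = "\<lambda>x. R #> x"
  interpret \<pi>: group_hom G "G Mod R" ?\<pi> by (rule R.quotient_hom)
  \<comment> \<open>The product of P and R is the preimage of the image of P modulo R.\<close>
  have absorb: "P \<subseteq> R" if P: "P \<lhd> G" "P \<subseteq> N" "in_class \<XX> (G\<lparr>carrier := P\<rparr>)" for P
  proof -
    have sP: "subgroup P G" using P(1) by (rule normal_imp_subgroup)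
    have M: "?\<pi> ` P \<lhd> G Mod R"
      using normal.surj_hom_normal_subgroup[OF P(1) \<pi>.group_hom_axioms R.quotient_surj] .
    let ?E = "{x \<in> carrier G. ?\<pi> x \<in> ?\<pi> ` P}"
    have "?E \<lhd> G" by (rule \<pi>.preimage_normal[OF M])
    moreover have "?E \<subseteq> N"
    proof
      fix x assume "x \<in> ?E"
      then obtain y where x: "x \<in> carrier G" and y: "y \<in> P" "R #> x = R #> y" by blast
      have yN: "y \<in> N" using y(1) P(2) by blast
      have "x \<in> R #> y" using G.rcos_self[OF x R.subgroup_axioms] y(2) by simp
      then have "x \<otimes> inv y \<in> N" using R.rcos_module_imp[OF G.is_group] yN NG RN by blast
      then have "x \<otimes> inv y \<otimes> y \<in> N" using subgroup.m_closed[OF sN] yN by blast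
      then show "x \<in> N" using x yN NG by (auto simp: G.m_assoc)
    qed
    moreover have "in_class \<XX> (G\<lparr>carrier := ?E\<rparr>)"
      by (rule R.in_class_preimage[OF \<XX> fin RX normal_imp_subgroup[OF M]
            in_class_image[OF \<XX> G.is_group \<pi>.H.is_group \<pi>.homh sP P(3)]])
    moreover have "R \<subseteq> ?E"
    proof -
      have "R \<in> ?\<pi> ` P"
        using subgroup.one_closed[OF sP] R.rcos_const[OF G.is_group subgroup.one_closed[OF R.subgroup_axioms]]
        by (metis image_eqI)
      then show ?thesis using R.rcos_const[OF G.is_group] R.subset by auto
    qed
    ultimately have "R = ?E" using R(2) by blast
    then show ?thesis using subgroup.subset[OF sP] by blast
  qed
  have "R \<noteq> {}" using subgroup.one_closed[OF R.subgroup_axioms] by blast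
  then have cardR: "card R > 0" using finite_subset[OF RN finN] by (simp add: card_gt_0_iff)
  have "N \<noteq> {}" using subgroup.one_closed[OF sN] by blast
  then have cardN: "card N > 0" using finN by (simp add: card_gt_0_iff)
  have "card N dvd card R"
  proof (rule multiplicity_le_imp_dvd)
    fix p :: nat assume p: "prime p"
    obtain P n where P: "subgroup P (G\<lparr>carrier := N\<rparr>)" "card P = p ^ n"
      "\<not> p dvd card N div p ^ n" "n = multiplicity p (card N)"
      using group.exists_sylow_subgroup[OF G.subgroup_imp_group[OF sN] p] finN
      by (auto simp: order_def)
    have PN: "P \<subseteq> N" using subgroup.subset[OF P(1)] by simp
    have PG: "subgroup P G" using G.incl_subgroup[OF sN P(1)] .
    show "multiplicity p (card N) \<le> multiplicity p (card R)"
    proof (cases "n = 0")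
      case False
      then have "P \<subseteq> R" using sylow[OF PG PN p P(2,3)] absorb PN by blast
      then have "p ^ n dvd card R"
        using G.subgroup_card_dvd[OF PG R.subgroup_axioms] P(2) by simp
      then show ?thesis using P(4) cardR p by (simp add: multiplicity_geI prime_nat_iff)
    qed (use P(4) in simp)
  qed (use cardN in simp)
  then have "card N \<le> card R" using cardR by (simp add: dvd_imp_le)
  then have "R = N" using card_seteq[OF finN RN] by simp
  show ?thesis
  proof (rule in_class_extension[OF \<XX> G.is_group fin H.is_group homh])
    show "in_class \<XX> (G\<lparr>carrier := kernel G H h\<rparr>)" using RX \<open>R = N\<close> N_def by simp
    show "in_class \<XX> (H\<lparr>carrier := h ` carrier G\<rparr>)" using H surj by simp
  qed
qed

text \<open>
  The given epimorphism, restricted to a minimal subgroup with image \<open>K\<close>, is a minimal cover of \<open>K\<close>.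
\<close>

lemma (in group_hom) lift_x_subgroup:
  assumes \<XX>: "complete_class \<XX>" and fin: "finite (carrier G)"
    and K: "x_subgroup \<XX> H K" "K \<subseteq> h ` carrier G"
  obtains S where "x_subgroup \<XX> G S" "h ` S = K"
proof -
  have sK: "subgroup K H" and KX: "in_class \<XX> (H\<lparr>carrier := K\<rparr>)"
    using K(1) unfolding x_subgroup_def by auto
  let ?F = "{S. subgroup S G \<and> h ` S = K}"
  have sub: "S \<subseteq> carrier G" if "subgroup S G" for S using that by (rule subgroup.subset)
  have finF: "finite ?F" by (rule finite_subset[of _ "Pow (carrier G)"]) (use sub fin in auto)
  have "{x \<in> carrier G. h x \<in> K} \<in> ?F"
    using preimage_subgroup[OF sK] image_preimage[OF refl K(2)] by simp
  then have "?F \<noteq> {}" by (rule ex_in_conv[THEN iffD1, OF exI])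
  then obtain S where S: "S \<in> ?F" "\<forall>T\<in>?F. T \<subseteq> S \<longrightarrow> S = T"
    by (rule bexE[OF finite_has_minimal[OF finF]])
  have sS: "subgroup S G" and hS: "h ` S = K" using S(1) by auto
  let ?G = "G\<lparr>carrier := S\<rparr>" and ?H = "H\<lparr>carrier := K\<rparr>"
  have "h \<in> hom ?G ?H"
    using hS sub[OF sS] by (auto simp: hom_def subset_iff)
  then interpret r: group_hom ?G ?H h
    using G.subgroup_imp_group[OF sS] H.subgroup_imp_group[OF sK]
    by (simp add: group_hom_def group_hom_axioms_def)
  have "in_class \<XX> ?G"
  proof (rule r.minimal_cover_in_class[OF \<XX> _ KX])
    show "finite (carrier ?G)" using finite_subset[OF sub[OF sS] fin] by simp
    show "h ` carrier ?G = carrier ?H" using hS by simp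
    fix T assume T: "subgroup T ?G" "h ` T = carrier ?H"
    have "subgroup T G" using G.incl_subgroup[OF sS T(1)] .
    moreover have "T \<subseteq> S" using subgroup.subset[OF T(1)] by simp
    ultimately have "S = T" using S(2) T(2) by simp
    then show "T = carrier ?G" by simp
  qed
  then show ?thesis using that sS hS unfolding x_subgroup_def by blast
qed

lemma (in group_hom) x_subgroup_image:
  assumes "complete_class \<XX>" "x_subgroup \<XX> G S"
  shows "x_subgroup \<XX> H (h ` S)"
  using assms in_class_image[OF assms(1) G.is_group H.is_group homh] subgroup_img_is_subgroup
  unfolding x_subgroup_def by blast

lemma (in group) x_subgroup_le_x_maximal:
  assumes "finite (carrier G)" "x_subgroup \<XX> G S"
  obtains M where "x_maximal \<XX> G M" "S \<subseteq> M"
proof -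
  let ?F = "{M. x_subgroup \<XX> G M}"
  have sub: "M \<subseteq> carrier G" if "x_subgroup \<XX> G M" for M
    using that subgroup.subset[of M G] unfolding x_subgroup_def by simp
  have finF: "finite ?F"
    by (rule finite_subset[of _ "Pow (carrier G)"]) (use sub assms(1) in auto)
  have "S \<in> ?F" using assms(2) by simp
  then obtain M where "M \<in> ?F" "S \<subseteq> M \<and> (\<forall>K\<in>?F. M \<subseteq> K \<longrightarrow> M = K)"
    by (rule bexE[OF finite_has_maximal2[OF finF]])
  then have "x_maximal \<XX> G M" "S \<subseteq> M" unfolding x_maximal_def by auto
  then show ?thesis by (rule that)
qed

lemma (in group_hom) x_maximal_is_image:
  assumes \<XX>: "complete_class \<XX>" and fin: "finite (carrier G)" and surj: "h ` carrier G = carrier H"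
    and K: "x_maximal \<XX> H K"
  obtains M where "x_maximal \<XX> G M" "h ` M = K"
proof -
  have "x_subgroup \<XX> H K" using K unfolding x_maximal_def by blast
  then obtain S where S: "x_subgroup \<XX> G S" "h ` S = K"
    using lift_x_subgroup[OF \<XX> fin] H.x_maximal_subset[OF K] surj by metis
  obtain M where M: "x_maximal \<XX> G M" "S \<subseteq> M"
    using G.x_subgroup_le_x_maximal[OF fin S(1)] .
  have "x_subgroup \<XX> H (h ` M)"
    using x_subgroup_image[OF \<XX>] M(1) unfolding x_maximal_def by blast
  moreover have "K \<subseteq> h ` M" using S(2) M(2) by blast
  ultimately have "h ` M = K" using K unfolding x_maximal_def by simp
  then show ?thesis by (rule that[OF M(1)])
qed

section \<open>Counting classes\<close>

lemma (in group) orbit_conj_eq_iff: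
  assumes "H \<subseteq> carrier G" "K \<subseteq> carrier G"
  shows "orbit G (subgroup_conj G) H = orbit G (subgroup_conj G) K \<longleftrightarrow> H \<in> orbit G (subgroup_conj G) K"
proof
  assume "orbit G (subgroup_conj G) H = orbit G (subgroup_conj G) K"
  then show "H \<in> orbit G (subgroup_conj G) K" using orbit_conj_refl[OF assms(1)] by simp
next
  assume H: "H \<in> orbit G (subgroup_conj G) K"
  have K: "K \<in> orbit G (subgroup_conj G) H" by (rule orbit_conj_sym[OF assms(2) H])
  show "orbit G (subgroup_conj G) H = orbit G (subgroup_conj G) K"
    using orbit_conj_trans[OF assms(1) K] orbit_conj_trans[OF assms(2) H] by blast
qed

text \<open>
  In this form the number of classes can be read off from a scheme, and a set of
  pairwise non-conjugate \<open>\<XX>\<close>-maximal subgroups can be recognized as a scheme by its size.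
\<close>

lemma (in group) x_scheme_iff_bij_betw:
  "x_scheme \<XX> G S \<longleftrightarrow> S \<subseteq> {H. x_maximal \<XX> G H} \<and>
    bij_betw (orbit G (subgroup_conj G)) S (orbits G {H. x_maximal \<XX> G H} (subgroup_conj G))"
    (is "_ \<longleftrightarrow> S \<subseteq> ?M \<and> bij_betw ?c S ?O")
proof
  assume S: "x_scheme \<XX> G S"
  then have SM: "S \<subseteq> ?M" unfolding x_scheme_def by blast
  have unique: "\<exists>!H. H \<in> S \<and> H \<in> ?c M" if "x_maximal \<XX> G M" for M
    using S that unfolding x_scheme_def by blast
  have "inj_on ?c S"
  proof (rule inj_onI)
    fix H K assume HK: "H \<in> S" "K \<in> S" "?c H = ?c K"
    have max: "x_maximal \<XX> G H" "x_maximal \<XX> G K" using HK SM by auto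
    have "H \<in> ?c H" "K \<in> ?c H"
      using orbit_conj_refl[OF x_maximal_subset[OF max(1)]]
        orbit_conj_refl[OF x_maximal_subset[OF max(2)]] HK(3) by simp_all
    then show "H = K" using unique[OF max(1)] HK(1,2) by blast
  qed
  moreover have "?c ` S = ?O"
  proof
    show "?c ` S \<subseteq> ?O" using SM unfolding orbits_def by blast
    show "?O \<subseteq> ?c ` S"
    proof
      fix C assume "C \<in> ?O"
      then obtain M where M: "x_maximal \<XX> G M" "C = ?c M" unfolding orbits_def by blast
      obtain H where H: "H \<in> S" "H \<in> ?c M" using unique[OF M(1)] by blast
      have "x_maximal \<XX> G H" using H(1) SM by blast
      then have "?c H = ?c M"
        using orbit_conj_eq_iff[OF x_maximal_subset x_maximal_subset] M(1) H(2) by blast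
      then show "C \<in> ?c ` S" using H(1) M(2) by blast
    qed
  qed
  ultimately show "S \<subseteq> ?M \<and> bij_betw ?c S ?O" using SM unfolding bij_betw_def by blast
next
  assume S: "S \<subseteq> ?M \<and> bij_betw ?c S ?O"
  show "x_scheme \<XX> G S"
    unfolding x_scheme_def
  proof (intro conjI ballI allI impI)
    fix H assume "H \<in> S" then show "x_maximal \<XX> G H" using S by blast
  next
    fix M assume M: "x_maximal \<XX> G M"
    then have "?c M \<in> ?c ` S" using S unfolding bij_betw_def orbits_def by blast
    then obtain H where H: "H \<in> S" "?c H = ?c M" by auto
    have in_iff: "K \<in> ?c M \<longleftrightarrow> ?c K = ?c M" if "K \<in> S" for K
      using orbit_conj_eq_iff[OF x_maximal_subset x_maximal_subset[OF M]] that S by blast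
    show "\<exists>!H. H \<in> S \<and> H \<in> ?c M"
    proof (rule ex1I)
      show "H \<in> S \<and> H \<in> ?c M" using H in_iff by blast
    next
      fix K assume "K \<in> S \<and> K \<in> ?c M"
      then have "K \<in> S" "?c K = ?c H" using in_iff H(2) by auto
      then show "K = H" using S H(1) unfolding bij_betw_def inj_on_def by blast
    qed
  qed
qed

lemma (in group) card_x_scheme: "x_scheme \<XX> G S \<Longrightarrow> card S = k_class \<XX> G"
  unfolding k_class_def using x_scheme_iff_bij_betw bij_betw_same_card by blast

lemma (in group) x_schemeI_card:
  assumes fin: "finite (carrier G)" and S: "S \<subseteq> {H. x_maximal \<XX> G H}"
    and inj: "inj_on (orbit G (subgroup_conj G)) S" and card: "card S = k_class \<XX> G"
  shows "x_scheme \<XX> G S"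
proof -
  let ?O = "orbits G {H. x_maximal \<XX> G H} (subgroup_conj G)"
  have "finite {H. x_maximal \<XX> G H}"
    by (rule finite_subset[of _ "Pow (carrier G)"]) (use x_maximal_subset fin in auto)
  then have finO: "finite ?O" by (simp add: orbits_def)
  have "orbit G (subgroup_conj G) ` S \<subseteq> ?O" using S unfolding orbits_def by blast
  then have "orbit G (subgroup_conj G) ` S = ?O"
    using card_subset_eq[OF finO] card_image[OF inj] card unfolding k_class_def by metis
  then show ?thesis using x_scheme_iff_bij_betw S inj unfolding bij_betw_def by blast
qed

lemma isoschematism_imp_k_class_eq:
  assumes "group G" "group G'" "isoschematism \<XX> G G' \<phi>"
  shows "k_class \<XX> G = k_class \<XX> G'"
proof -
  obtain S where S: "x_scheme \<XX> G S" "inj_on ((`) \<phi>) S" "x_scheme \<XX> G' ((`) \<phi> ` S)"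
    using assms(3) unfolding isoschematism_def carries_scheme_def by blast
  have "k_class \<XX> G = card S" using group.card_x_scheme[OF assms(1) S(1)] by simp
  also have "\<dots> = card ((`) \<phi> ` S)" using card_image[OF S(2)] by simp
  also have "\<dots> = k_class \<XX> G'" by (rule group.card_x_scheme[OF assms(2) S(3)])
  finally show ?thesis .
qed

text \<open>
  Preimages of the members of a scheme of \<open>G'\<close> are pairwise non-conjugate, because a homomorphism
  preserves conjugacy. Equality of the numbers of classes forces them to exhaust the classes of \<open>G\<close>.
\<close>

lemma k_class_eq_imp_isoschematism:
  assumes \<XX>: "complete_class \<XX>" and G: "group G" "finite (carrier G)" and G': "group G'"
    and \<phi>: "\<phi> \<in> epi G G'" and k: "k_class \<XX> G = k_class \<XX> G'"
  shows "isoschematism \<XX> G G' \<phi>"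
proof -
  have hom: "\<phi> \<in> hom G G'" and surj: "\<phi> ` carrier G = carrier G'"
    using \<phi> unfolding epi_def by auto
  interpret group_hom G G' \<phi>
    using G(1) G' hom by (simp add: group_hom_def group_hom_axioms_def)
  obtain T where T: "x_scheme \<XX> G' T" using H.x_scheme_exists by blast
  have "\<exists>M. x_maximal \<XX> G M \<and> \<phi> ` M = K" if "K \<in> T" for K
    using x_maximal_is_image[OF \<XX> G(2) surj] that T unfolding x_scheme_def by metis
  then obtain m where m: "\<And>K. K \<in> T \<Longrightarrow> x_maximal \<XX> G (m K)" "\<And>K. K \<in> T \<Longrightarrow> \<phi> ` m K = K"
    by metis
  let ?S = "m ` T"
  have im: "(`) \<phi> ` ?S = T" using m(2) by (force simp: image_iff)
  have injm: "inj_on m T" by (rule inj_on_inverseI[where g = "(`) \<phi>"]) (rule m(2))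
  have inj\<phi>: "inj_on ((`) \<phi>) ?S"
    by (rule inj_onI) (use m(2) in auto)
  have "x_scheme \<XX> G ?S"
  proof (rule G.x_schemeI_card[OF G(2)])
    show "?S \<subseteq> {H. x_maximal \<XX> G H}" using m(1) by blast
    show "card ?S = k_class \<XX> G" using card_image[OF injm] H.card_x_scheme[OF T] k by simp
    have "m K = m L" if KL: "K \<in> T" "L \<in> T"
      "orbit G (subgroup_conj G) (m K) = orbit G (subgroup_conj G) (m L)" for K L
    proof -
      have sub: "m K \<subseteq> carrier G" "m L \<subseteq> carrier G"
        using G.x_maximal_subset m(1) KL(1,2) by blast+
      have T': "x_maximal \<XX> G' K" "x_maximal \<XX> G' L" using T KL(1,2) unfolding x_scheme_def by auto
      have "m K \<in> orbit G (subgroup_conj G) (m L)" using G.orbit_conj_eq_iff[OF sub] KL(3) by blast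
      then have "K \<in> orbit G' (subgroup_conj G') L"
        using image_orbit_conj[OF G(1) G' hom sub(2)] m(2) KL(1,2) by metis
      moreover have "L \<in> orbit G' (subgroup_conj G') L"
        by (rule H.orbit_conj_refl[OF H.x_maximal_subset[OF T'(2)]])
      ultimately have "K = L" using T T'(2) KL(1,2) unfolding x_scheme_def by blast
      then show ?thesis by simp
    qed
    then show "inj_on (orbit G (subgroup_conj G)) ?S" unfolding inj_on_def ball_simps by blast
  qed
  moreover have "carries_scheme \<XX> G G' \<phi> ?S"
    unfolding carries_scheme_def im using inj\<phi> T by (rule conjI)
  ultimately show ?thesis using \<phi> unfolding isoschematism_def by blast
qed

theorem mainTheorem5:
  fixes \<XX> :: "nat monoid set"
    and G :: "('a, 'm) monoid_scheme"
    and G' :: "('b, 'n) monoid_scheme"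
  assumes "complete_class \<XX>"
    and "group G" and "finite (carrier G)"
    and "group G'" and "epi G G' \<noteq> {}"
  shows "((\<exists>\<phi>. isoschematism \<XX> G G' \<phi>) \<longleftrightarrow> (\<forall>\<phi>\<in>epi G G'. isoschematism \<XX> G G' \<phi>)) \<and>
         ((\<forall>\<phi>\<in>epi G G'. isoschematism \<XX> G G' \<phi>) \<longleftrightarrow> k_class \<XX> G = k_class \<XX> G')"
proof -
  let ?i = "\<exists>\<phi>. isoschematism \<XX> G G' \<phi>"
    and ?ii = "\<forall>\<phi>\<in>epi G G'. isoschematism \<XX> G G' \<phi>"
    and ?iii = "k_class \<XX> G = k_class \<XX> G'"
  have ii_i: "?ii \<Longrightarrow> ?i" using assms(5) by blast
  have i_iii: "?i \<Longrightarrow> ?iii" using isoschematism_imp_k_class_eq[OF assms(2,4)] by blast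
  have iii_ii: "?iii \<Longrightarrow> ?ii" using k_class_eq_imp_isoschematism[OF assms(1-4)] by blast
  show ?thesis
  proof (intro conjI iffI)
    assume ?i then show ?ii by (rule iii_ii[OF i_iii])
  next
    assume ?ii then show ?i by (rule ii_i)
  next
    assume ?ii then show ?iii by (rule i_iii[OF ii_i])
  next
    assume ?iii then show ?ii by (rule iii_ii)
  qed
qed

end
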